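(* Let $H_1,H_2\in(0,1)\setminus\{\frac12\}$ with $H=H_1+H_2<1$, and let $Y=(Y^1,Y^2)$ be the bivariate fractional Ornstein–Uhlenbeck process. Let $(\Delta_n)$ be a sequence of positive numbers such that $\Delta_n\to0$ and $n\Delta_n\to+\infty$ as $n\to+\infty$, and let $$\tilde\eta_{12,n}=\frac1{\nu_1\nu_2n\Delta_n^H}\sum_{k=0}^{n-1}\big(Y^1_{k\Delta_n}Y^2_{(k+1)\Delta_n}-Y^1_{(k+1)\Delta_n}Y^2_{k\Delta_n}\big).$$ Then $\tilde\eta_{12,n}\to\eta_{12}$ in $L^2(\mathbb P)$ and in probability, as $n\to+\infty$.
   Context: Bivariate fractional Brownian motion ($H=H_1+H_2\ne1$). $(B^{H_1}_t,B^{H_2}_t)_{t\in\mathbb R}$ is a centered Gaussian process such that each $B^{H_i}$ is a fractional Brownian motion on $\mathbb R$ with Hurst index $H_i$, $\mathrm{Var}(B^{H_i}_1)=1$, and for $i\ne j$ $$\mathbb E[B^{H_i}_tB^{H_j}_s]=\tfrac12\big((\rho+\mathrm{sign}(t)\eta_{ij})|t|^H+(\rho-\mathrm{sign}(s)\eta_{ij})|s|^H-(\rho-\mathrm{sign}(s-t)\eta_{ij})|s-t|^H\big),$$ with $\mathrm{sign}(x)=1$ for $x\ge0$, $-1$ for $x<0$; $\rho\in[-1,1]$ and $\eta_{12}=-\eta_{21}\in\mathbb R$ are such that this is a valid covariance. Bivariate fractional Ornstein–Uhlenbeck process: $Y^i_t=\nu_i\int_{-\infty}^te^{-\alpha_i(t-u)}dB^{H_i}_u$,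 $t\in\mathbb R$, $i=1,2$ (pathwise Riemann–Stieltjes integrals), with $\alpha_i,\nu_i>0$. *)

theory Defs
  imports "HOL-Probability.Probability"
begin

text \<open>Point masses count as Gaussian (variance zero).\<close>

definition gaussian_rv :: "'w measure \<Rightarrow> ('w \<Rightarrow> real) \<Rightarrow> bool" where
  "gaussian_rv M X \<longleftrightarrow> X \<in> borel_measurable M \<and>
     ((\<exists>m. AE \<omega> in M. X \<omega> = m) \<or>
      (\<exists>m s. s > 0 \<and> distributed M lborel X (\<lambda>x. ennreal (normal_density m s x))))"

definition gaussian_process :: "'w measure \<Rightarrow> 'i set \<Rightarrow> ('i \<Rightarrow> 'w \<Rightarrow> real) \<Rightarrow> bool" where
  "gaussian_process M I X \<longleftrightarrow>
     (\<forall>J c. finite J \<and> J \<subseteq> I \<longrightarrow> gaussian_rv M (\<lambda>\<omega>. \<Sum>i\<in>J. c i * X i \<omega>))"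

definition centered_gaussian_process ::
    "'w measure \<Rightarrow> 'i set \<Rightarrow> ('i \<Rightarrow> 'w \<Rightarrow> real) \<Rightarrow> bool" where
  "centered_gaussian_process M I X \<longleftrightarrow>
     gaussian_process M I X \<and> (\<forall>i\<in>I. integral\<^sup>L M (X i) = 0)"

text \<open>
  Continuity of the paths is not part of the definition; the only pathwise property used below
  is the existence of the integrals defining the Ornstein--Uhlenbeck process.
\<close>

definition fractional_brownian_motion ::
    "'w measure \<Rightarrow> real \<Rightarrow> (real \<Rightarrow> 'w \<Rightarrow> real) \<Rightarrow> bool" where
  "fractional_brownian_motion M h X \<longleftrightarrow>
     0 < h \<and> h < 1 \<and> centered_gaussian_process M UNIV X \<and>
     (\<forall>t s. integral\<^sup>L M (\<lambda>\<omega>. X t \<omega> * X s \<omega>) =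
        integral\<^sup>L M (\<lambda>\<omega>. (X 1 \<omega>)\<^sup>2) / 2 *
          (\<bar>t\<bar> powr (2 * h) + \<bar>s\<bar> powr (2 * h) - \<bar>t - s\<bar> powr (2 * h)))"

text \<open>Unlike \<^const>\<open>sgn\<close>, this takes the value 1 at 0.\<close>

definition sign01 :: "real \<Rightarrow> real" where
  "sign01 x = (if x \<ge> 0 then 1 else - 1)"

text \<open>
  Components are indexed by 1 and 2; the values of \<open>H\<close>, \<open>\<eta>\<close>, \<open>B\<close> at other indices are irrelevant.
  Admissibility of \<open>\<rho>\<close> and \<open>\<eta>\<close> (positive semidefiniteness) is implied by the existence
  of the process \<open>B\<close>.
\<close>

definition bivariate_fbm ::
    "'w measure \<Rightarrow> (nat \<Rightarrow> real) \<Rightarrow> real \<Rightarrow> (nat \<Rightarrow> nat \<Rightarrow> real) \<Rightarrow> (nat \<Rightarrow> real \<Rightarrow> 'w \<Rightarrow> real) \<Rightarrow> bool" where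
  "bivariate_fbm M H \<rho> \<eta> B \<longleftrightarrow>
     H 1 + H 2 \<noteq> 1 \<and> - 1 \<le> \<rho> \<and> \<rho> \<le> 1 \<and> \<eta> 1 2 = - \<eta> 2 1 \<and>
     centered_gaussian_process M ({1, 2} \<times> UNIV) (\<lambda>(i, t). B i t) \<and>
     (\<forall>i\<in>{1, 2}. fractional_brownian_motion M (H i) (B i) \<and>
        integral\<^sup>L M (\<lambda>\<omega>. (B i 1 \<omega>)\<^sup>2) = 1) \<and>
     (\<forall>i\<in>{1, 2}. \<forall>j\<in>{1, 2}. i \<noteq> j \<longrightarrow>
        (\<forall>t s. integral\<^sup>L M (\<lambda>\<omega>. B i t \<omega> * B j s \<omega>) =
           1 / 2 * ((\<rho> + sign01 t * \<eta> i j) * \<bar>t\<bar> powr (H 1 + H 2)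
                  + (\<rho> - sign01 s * \<eta> i j) * \<bar>s\<bar> powr (H 1 + H 2)
                  - (\<rho> - sign01 (s - t) * \<eta> i j) * \<bar>s - t\<bar> powr (H 1 + H 2))))"

text \<open>The limit is taken as the mesh of the tagged division tends to 0, with a constant gauge.\<close>

definition has_rs_integral ::
    "(real \<Rightarrow> real) \<Rightarrow> (real \<Rightarrow> real) \<Rightarrow> real \<Rightarrow> real \<Rightarrow> real \<Rightarrow> bool" where
  "has_rs_integral f g a b I \<longleftrightarrow>
     (\<forall>e>0. \<exists>d>0. \<forall>p. p tagged_division_of {a..b} \<and> (\<forall>(x, K)\<in>p. Sup K - Inf K < d) \<longrightarrow>
        \<bar>(\<Sum>(x, K)\<in>p. f x * (g (Sup K) - g (Inf K))) - I\<bar> < e)"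

definition has_rs_integral_at_bot ::
    "(real \<Rightarrow> real) \<Rightarrow> (real \<Rightarrow> real) \<Rightarrow> real \<Rightarrow> real \<Rightarrow> bool" where
  "has_rs_integral_at_bot f g b I \<longleftrightarrow>
     (\<exists>F. (\<forall>a\<le>b. has_rs_integral f g a b (F a)) \<and> (F \<longlongrightarrow> I) at_bot)"

definition fractional_ou ::
    "'w measure \<Rightarrow> real \<Rightarrow> real \<Rightarrow> (real \<Rightarrow> 'w \<Rightarrow> real) \<Rightarrow> (real \<Rightarrow> 'w \<Rightarrow> real) \<Rightarrow> bool" where
  "fractional_ou M \<alpha> \<nu> X Y \<longleftrightarrow>
     (\<forall>t. Y t \<in> borel_measurable M) \<and>
     (AE \<omega> in M. \<forall>t. \<exists>I.
        has_rs_integral_at_bot (\<lambda>u. exp (- \<alpha> * (t - u))) (\<lambda>u. X u \<omega>) t I \<and> Y t \<omega> = \<nu> * I)"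

definition bivariate_fou ::
    "'w measure \<Rightarrow> (nat \<Rightarrow> real) \<Rightarrow> (nat \<Rightarrow> real) \<Rightarrow> (nat \<Rightarrow> real \<Rightarrow> 'w \<Rightarrow> real) \<Rightarrow>
     (nat \<Rightarrow> real \<Rightarrow> 'w \<Rightarrow> real) \<Rightarrow> bool" where
  "bivariate_fou M \<alpha> \<nu> B Y \<longleftrightarrow>
     (\<forall>i\<in>{1, 2}. \<alpha> i > 0 \<and> \<nu> i > 0 \<and> fractional_ou M (\<alpha> i) (\<nu> i) (B i) (Y i))"

definition eta_tilde ::
    "(nat \<Rightarrow> real) \<Rightarrow> (nat \<Rightarrow> real) \<Rightarrow> (nat \<Rightarrow> real) \<Rightarrow> (nat \<Rightarrow> real \<Rightarrow> 'w \<Rightarrow> real) \<Rightarrow> nat \<Rightarrow> 'w \<Rightarrow> real" where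
  "eta_tilde H \<nu> \<Delta> Y n \<omega> =
     1 / (\<nu> 1 * \<nu> 2 * real n * \<Delta> n powr (H 1 + H 2)) *
     (\<Sum>k<n. Y 1 (real k * \<Delta> n) \<omega> * Y 2 (real (k + 1) * \<Delta> n) \<omega>
           - Y 1 (real (k + 1) * \<Delta> n) \<omega> * Y 2 (real k * \<Delta> n) \<omega>)"

definition converges_in_L2 ::
    "'w measure \<Rightarrow> (nat \<Rightarrow> 'w \<Rightarrow> real) \<Rightarrow> ('w \<Rightarrow> real) \<Rightarrow> bool" where
  "converges_in_L2 M X Z \<longleftrightarrow>
     (\<forall>n. X n \<in> borel_measurable M \<and> integrable M (\<lambda>\<omega>. (X n \<omega>)\<^sup>2)) \<and>
     Z \<in> borel_measurable M \<and> integrable M (\<lambda>\<omega>. (Z \<omega>)\<^sup>2) \<and>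
     (\<lambda>n. integral\<^sup>L M (\<lambda>\<omega>. (X n \<omega> - Z \<omega>)\<^sup>2)) \<longlonglongrightarrow> 0"

definition converges_in_probability ::
    "'w measure \<Rightarrow> (nat \<Rightarrow> 'w \<Rightarrow> real) \<Rightarrow> ('w \<Rightarrow> real) \<Rightarrow> bool" where
  "converges_in_probability M X Z \<longleftrightarrow>
     (\<forall>n. X n \<in> borel_measurable M) \<and> Z \<in> borel_measurable M \<and>
     (\<forall>e>0. (\<lambda>n. measure M {\<omega> \<in> space M. \<bar>X n \<omega> - Z \<omega>\<bar> > e}) \<longlonglongrightarrow> 0)"

end

theory Submission
  imports Defs
begin

text \<open>
  Write \<open>I\<^sub>i = Y\<^sub>i / \<nu>\<^sub>i\<close> and \<open>p = H\<^sub>1 + H\<^sub>2\<close>. Up to sign, the two components may be interchanged so that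
  \<open>H\<^sub>1 > 1/2\<close> or both indices are below \<open>1/2\<close>. Summation by parts turns the statistic into a boundary
  term minus the sum of \<open>(I\<^sub>1(k+1) - I\<^sub>1(k)) (I\<^sub>2(k) + I\<^sub>2(k+1))\<close>, and by the Langevin equation
  \<open>I\<^sub>1(k+1) - I\<^sub>1(k)\<close> is the increment \<open>A\<^sub>k\<close> of \<open>B\<^sub>1\<close> up to an error of order \<open>\<Delta>\<close> in mean square, negligible
  against \<open>\<Delta>\<^sup>p\<close>. For \<open>S\<^sub>k = I\<^sub>2(k) + I\<^sub>2(k+1)\<close> the covariance of \<open>A\<^sub>k\<close> and \<open>S\<^sub>l\<close> is, up to \<open>O(\<Delta>)\<close>, half a
  centred difference of the kernel \<open>(\<rho> - sign(x) \<eta>) |x|\<^sup>p\<close>; at \<open>k = l\<close> this is \<open>- \<eta> \<Delta>\<^sup>p\<close>, which gives the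
  limit. By Isserlis' formula the variance of the sum of \<open>A\<^sub>k S\<^sub>k\<close> is bounded by the sum of the
  \<open>|cov A\<^sub>k A\<^sub>l|\<close>, controlled by the constant sign of the second differences of \<open>|x|\<close> to the power
  \<open>2 H\<^sub>1\<close>, and by the sum of the \<open>(cov A\<^sub>k S\<^sub>l)\<^sup>2\<close>, which telescopes.

  All estimates are made for the Riemann sums defining \<open>I\<^sub>i\<close>, which lie in the Gaussian space of
  \<open>B\<close>, uniformly in mesh and truncation; Fatou's lemma carries them over to \<open>Y\<close>.
\<close>

section \<open>Exponentially weighted sums of increments\<close>

text \<open>The Riemann-Stieltjes sum of \<open>exp (- a * (t - u))\<close> against \<beta> over the
  window of length \<open>m * h\<close> ending at \<open>t\<close>. Cells are counted backwards and
  tagged at their left endpoints, hence the exponent \<open>Suc j\<close>. Writing the weights as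
  powers turns concatenation of windows into a geometric shift.\<close>

definition exp_filter :: "real \<Rightarrow> real \<Rightarrow> nat \<Rightarrow> (real \<Rightarrow> real) \<Rightarrow> real \<Rightarrow> real" where
  "exp_filter a h m \<beta> t =
     (\<Sum>j<m. exp (- a * h) ^ Suc j * (\<beta> (t - real j * h) - \<beta> (t - real (Suc j) * h)))"

lemma exp_filter_0 [simp]: "exp_filter a h 0 \<beta> t = 0"
  by (simp add: exp_filter_def)

lemma exp_filter_Suc:
  "exp_filter a h (Suc m) \<beta> t = exp_filter a h m \<beta> t
     + exp (- a * h) ^ Suc m * (\<beta> (t - real m * h) - \<beta> (t - real (Suc m) * h))"
  by (simp add: exp_filter_def)

text \<open>Cutting one window after its newest block and before its oldest block, and comparing,
  gives the discrete Langevin equation below.\<close>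

lemma exp_filter_add:
  "exp_filter a h (m + n) \<beta> t =
     exp_filter a h m \<beta> t + exp (- a * h) ^ m * exp_filter a h n \<beta> (t - real m * h)"
  by (induction n) (simp_all add: exp_filter_Suc algebra_simps power_add)

lemma exp_filter_diff:
  "exp_filter a h m (\<lambda>u. \<beta> u - \<gamma> u) t = exp_filter a h m \<beta> t - exp_filter a h m \<gamma> t"
  by (induction m) (simp_all add: exp_filter_Suc algebra_simps)

lemma exp_filter_scale:
  "exp_filter a h m (\<lambda>u. c * \<beta> u) t = c * exp_filter a h m \<beta> t"
  by (induction m) (simp_all add: exp_filter_Suc algebra_simps)

lemma exp_filter_const [simp]: "exp_filter a h m (\<lambda>u. c) t = 0"
  by (simp add: exp_filter_def)

lemma exp_filter_shift:
  "exp_filter a h m (\<lambda>u. \<beta> (u - s)) t = exp_filter a h m \<beta> (t - s)"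
  by (simp add: exp_filter_def algebra_simps)

lemma powr_le_one_plus:
  fixes x \<theta> :: real
  assumes "0 \<le> x" "0 < \<theta>" "\<theta> \<le> 1"
  shows "x powr \<theta> \<le> 1 + x"
proof (cases "x \<le> 1")
  case True
  then have "x powr \<theta> \<le> 1" using assms by (simp add: powr_le1)
  then show ?thesis using assms by simp
next
  case False
  then have "x powr \<theta> \<le> x powr 1" using assms by (intro powr_mono) auto
  then show ?thesis using False by simp
qed

text \<open>Applied to two kinds of deterministic path: \<open>u \<mapsto> cov Z (X u)\<close> for a
  fixed Gaussian variable \<open>Z\<close>, and the cross covariance kernel.\<close>

locale holder_path =
  fixes \<beta> :: "real \<Rightarrow> real" and C \<theta> a :: real
  assumes C: "0 \<le> C" and \<theta>: "0 < \<theta>" "\<theta> \<le> 1" and a: "0 < a"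
    and holder: "\<And>s t. \<bar>\<beta> t - \<beta> s\<bar> \<le> C * \<bar>t - s\<bar> powr \<theta>"
begin

text \<open>Abel summation turns the filter into a geometrically weighted sum of the increments
  \<open>c j\<close> from \<open>t\<close>, which grow at most linearly in \<open>j * h\<close>. The
  bound is uniform in the mesh \<open>h\<close>, the number of cells and \<open>t\<close>.\<close>

lemma exp_filter_bound:
  assumes h: "0 < h"
  shows "\<bar>exp_filter a h m \<beta> t\<bar> \<le> C * (1 + 1 / a)"
proof -
  define q where "q = exp (- a * h)"
  have q: "0 < q" "q < 1" using a h by (auto simp: q_def)
  define c where "c j = \<beta> t - \<beta> (t - real j * h)" for j :: nat
  have c: "\<bar>c j\<bar> \<le> C * (1 + real j * h)" for j
  proof -
    have "\<bar>c j\<bar> \<le> C * (real j * h) powr \<theta>"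
      using holder[of t "t - real j * h"] h by (simp add: c_def abs_mult)
    also have "\<dots> \<le> C * (1 + real j * h)"
      using powr_le_one_plus[of "real j * h" \<theta>] \<theta> h C by (intro mult_left_mono) auto
    finally show ?thesis .
  qed
  let ?P = "\<lambda>m. exp_filter a h m \<beta> t"
  let ?S = "\<lambda>m. 1 + h * (\<Sum>j<m. q ^ Suc j)"
  \<comment> \<open>The right side is \<open>C\<close> times the same Abel summation carried out for
    \<open>1 + j * h\<close> in place of \<open>c j\<close>.\<close>
  have main: "\<bar>?P m - q ^ m * c m\<bar> \<le> C * (?S m - q ^ m * (1 + real m * h))"
  proof (induction m)
    case 0
    then show ?case by (simp add: c_def)
  next
    case (Suc m)
    have "?P (Suc m) - q ^ Suc m * c (Suc m) = (?P m - q ^ m * c m) + (1 - q) * q ^ m * c m"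
      unfolding exp_filter_Suc q_def[symmetric] c_def by (simp add: algebra_simps)
    also have "\<bar>\<dots>\<bar> \<le> \<bar>?P m - q ^ m * c m\<bar> + (1 - q) * q ^ m * \<bar>c m\<bar>"
      using q by (intro order_trans[OF abs_triangle_ineq]) (simp add: abs_mult)
    also have "\<dots> \<le> C * (?S m - q ^ m * (1 + real m * h)) + (1 - q) * q ^ m * (C * (1 + real m * h))"
      using q by (intro add_mono Suc mult_left_mono c) auto
    also have "\<dots> = C * (?S (Suc m) - q ^ Suc m * (1 + real (Suc m) * h))"
      by (simp add: algebra_simps)
    finally show ?case .
  qed
  have "\<bar>?P m\<bar> \<le> \<bar>?P m - q ^ m * c m\<bar> + q ^ m * \<bar>c m\<bar>"
    using q abs_triangle_ineq[of "?P m - q ^ m * c m" "q ^ m * c m"] by (simp add: abs_mult)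
  also have "\<dots> \<le> C * (?S m - q ^ m * (1 + real m * h)) + q ^ m * (C * (1 + real m * h))"
    using q by (intro add_mono main mult_left_mono c) auto
  also have "\<dots> = C * ?S m" by (simp add: algebra_simps)
  \<comment> \<open>\<open>h\<close> times the geometric sum is a lower Riemann sum of
    \<open>exp (- a * u)\<close> over the half-line, whose integral is \<open>1 / a\<close>.\<close>
  also have "\<dots> \<le> C * (1 + 1 / a)"
  proof (intro mult_left_mono C add_left_mono)
    have "(\<Sum>j<m. q ^ Suc j) = q * (\<Sum>j<m. q ^ j)" by (simp add: sum_distrib_left)
    also have "\<dots> = q * ((1 - q ^ m) / (1 - q))" using q by (simp add: sum_gp_strict)
    also have "\<dots> \<le> q * (1 / (1 - q))"
      using q by (intro mult_left_mono divide_right_mono) auto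
    finally have s: "(\<Sum>j<m. q ^ Suc j) \<le> q / (1 - q)" by simp
    have "1 + a * h \<le> exp (a * h)" by (rule exp_ge_add_one_self)
    then have "q * (1 + a * h) \<le> q * exp (a * h)" using q by (intro mult_left_mono) auto
    also have "\<dots> = 1" by (simp add: q_def exp_minus)
    finally have "h * q * a \<le> 1 - q" by (simp add: algebra_simps)
    then have "h * (q / (1 - q)) \<le> 1 / a" using q a by (simp add: field_simps)
    then show "h * (\<Sum>j<m. q ^ Suc j) \<le> 1 / a"
      using s h by (meson mult_left_mono less_imp_le order_trans)
  qed
  finally show ?thesis .
qed

text \<open>With all weights equal to 1 the filter would telescope to the increment. Splitting off
  the newest cell, the error is \<open>q\<close> times the error one cell earlier minus
  \<open>1 - q\<close> times the full increment, and
  \<open>q * (1 - q ^ m) + (1 - q) = 1 - q ^ Suc m\<close>. Over a window of length \<open>D\<close>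
  this factor is at most \<open>a * D\<close>.\<close>

lemma exp_filter_gap:
  assumes h: "0 < h"
  shows "\<bar>exp_filter a h m \<beta> t - (\<beta> t - \<beta> (t - real m * h))\<bar>
           \<le> (1 - exp (- a * h) ^ m) * (C * (real m * h) powr \<theta>)"
proof (induction m arbitrary: t)
  case 0
  then show ?case by simp
next
  case (Suc m)
  define q where "q = exp (- a * h)"
  have q: "0 < q" "q < 1" using a h by (auto simp: q_def)
  let ?e = "\<lambda>m t. exp_filter a h m \<beta> t - (\<beta> t - \<beta> (t - real m * h))"
  have P: "exp_filter a h (Suc m) \<beta> t = q * (\<beta> t - \<beta> (t - h)) + q * exp_filter a h m \<beta> (t - h)"
    using exp_filter_add[of a h 1 m \<beta> t] by (simp add: exp_filter_Suc q_def)
  have arg: "t - h - real m * h = t - real (Suc m) * h" by (simp add: algebra_simps)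
  have "?e (Suc m) t = q * ?e m (t - h) - (1 - q) * (\<beta> t - \<beta> (t - real (Suc m) * h))"
    unfolding P arg by (simp add: algebra_simps)
  also have "\<bar>\<dots>\<bar> \<le> q * \<bar>?e m (t - h)\<bar> + (1 - q) * \<bar>\<beta> t - \<beta> (t - real (Suc m) * h)\<bar>"
    using q by (intro order_trans[OF abs_triangle_ineq4]) (simp add: abs_mult)
  also have "\<dots> \<le> q * ((1 - q ^ m) * (C * (real (Suc m) * h) powr \<theta>))
                  + (1 - q) * (C * (real (Suc m) * h) powr \<theta>)"
  proof (intro add_mono mult_left_mono)
    have "\<bar>?e m (t - h)\<bar> \<le> (1 - q ^ m) * (C * (real m * h) powr \<theta>)"
      using Suc by (simp add: q_def)
    also have "\<dots> \<le> (1 - q ^ m) * (C * (real (Suc m) * h) powr \<theta>)"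
      using q h \<theta> C by (intro mult_left_mono powr_mono2) (auto simp: power_le_one)
    finally show "\<bar>?e m (t - h)\<bar> \<le> (1 - q ^ m) * (C * (real (Suc m) * h) powr \<theta>)" .
    show "\<bar>\<beta> t - \<beta> (t - real (Suc m) * h)\<bar> \<le> C * (real (Suc m) * h) powr \<theta>"
      using holder[of t "t - real (Suc m) * h"] h by (simp add: abs_mult)
  qed (use q in auto)
  also have "\<dots> = (1 - q ^ Suc m) * (C * (real (Suc m) * h) powr \<theta>)"
    by (simp add: algebra_simps)
  finally show ?case by (simp add: q_def)
qed

text \<open>The continuous counterpart is the Langevin equation
  \<open>dY = - a Y dt + d\<beta>\<close>; the last summand of the bound pays for the truncation at lag \<open>L * D\<close>.\<close>

lemma exp_filter_increment:
  assumes D: "0 < D" and N: "0 < N" and h: "h = D / real N"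
    and L: "exp (- a * (real L * D)) \<le> D"
  shows "\<bar>exp_filter a h (L * N) \<beta> (t + D) - exp_filter a h (L * N) \<beta> t - (\<beta> (t + D) - \<beta> t)\<bar>
           \<le> C * D * (a * (1 + D) + (a + 1) * (1 + 1 / a))"
proof -
  define q where "q = exp (- a * h)"
  have h0: "0 < h" using D N h by simp
  have Nh: "real N * h = D" using N h by simp
  have qN: "q ^ N = exp (- a * D)"
    using Nh by (simp add: q_def exp_of_nat_mult[symmetric] algebra_simps)
  have "q ^ (L * N) = exp (- a * (real L * D))"
    using Nh by (simp add: q_def exp_of_nat_mult[symmetric] algebra_simps)
  then have qJ: "0 \<le> q ^ (L * N)" "q ^ (L * N) \<le> D" using L by auto
  have gapN: "0 \<le> 1 - q ^ N" "1 - q ^ N \<le> a * D"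
    using exp_ge_add_one_self[of "- a * D"] D a by (auto simp: qN)
  let ?P = "exp_filter a h"
  let ?B = "C * (1 + 1 / a)"
  \<comment> \<open>The window of \<open>N + L * N\<close> cells ending at \<open>t + D\<close> is
    cut in two ways: after its newest \<open>N\<close> cells, which span exactly \<open>D\<close>,
    and before its oldest \<open>N\<close> cells.\<close>
  have "?P (N + L * N) \<beta> (t + D) = ?P N \<beta> (t + D) + q ^ N * ?P (L * N) \<beta> t"
    unfolding exp_filter_add by (simp add: q_def Nh)
  moreover have "?P (N + L * N) \<beta> (t + D) = ?P (L * N) \<beta> (t + D)
      + q ^ (L * N) * ?P N \<beta> (t + D - real (L * N) * h)"
    unfolding add.commute[of N] exp_filter_add by (simp add: q_def)
  ultimately have "?P (L * N) \<beta> (t + D) - ?P (L * N) \<beta> t - (\<beta> (t + D) - \<beta> t) =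
      (?P N \<beta> (t + D) - (\<beta> (t + D) - \<beta> t)) - (1 - q ^ N) * ?P (L * N) \<beta> t
       - q ^ (L * N) * ?P N \<beta> (t + D - real (L * N) * h)"
    by (simp add: algebra_simps)
  also have "\<bar>\<dots>\<bar> \<le> \<bar>?P N \<beta> (t + D) - (\<beta> (t + D) - \<beta> t)\<bar> + \<bar>(1 - q ^ N) * ?P (L * N) \<beta> t\<bar>
       + \<bar>q ^ (L * N) * ?P N \<beta> (t + D - real (L * N) * h)\<bar>"
    by linarith
  also have "\<dots> \<le> a * D * (C * (1 + D)) + a * D * ?B + D * ?B"
  proof (intro add_mono)
    have "\<bar>?P N \<beta> (t + D) - (\<beta> (t + D) - \<beta> t)\<bar> \<le> (1 - q ^ N) * (C * D powr \<theta>)"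
      using exp_filter_gap[OF h0, of N "t + D"] by (simp add: Nh q_def)
    also have "\<dots> \<le> a * D * (C * (1 + D))"
      using gapN C D a powr_le_one_plus[of D \<theta>] \<theta> by (intro mult_mono mult_left_mono) auto
    finally show "\<bar>?P N \<beta> (t + D) - (\<beta> (t + D) - \<beta> t)\<bar> \<le> a * D * (C * (1 + D))" .
    show "\<bar>(1 - q ^ N) * ?P (L * N) \<beta> t\<bar> \<le> a * D * ?B"
      unfolding abs_mult using gapN exp_filter_bound[OF h0] by (intro mult_mono) auto
    show "\<bar>q ^ (L * N) * ?P N \<beta> (t + D - real (L * N) * h)\<bar> \<le> D * ?B"
      unfolding abs_mult using qJ D exp_filter_bound[OF h0] by (intro mult_mono) auto
  qed
  also have "\<dots> = C * D * (a * (1 + D) + (a + 1) * (1 + 1 / a))"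
    using a by (simp add: field_simps)
  finally show ?thesis .
qed

end

section \<open>Second differences of powers and the cross covariance kernel\<close>

lemma powr_add_le:
  fixes x y p :: real
  assumes "0 \<le> x" "0 \<le> y" "0 < p" "p \<le> 1"
  shows "(x + y) powr p \<le> x powr p + y powr p"
proof (cases "x + y = 0")
  case True
  then show ?thesis by simp
next
  case False
  then have pos: "0 < x + y" using assms by simp
  have le: "z / (x + y) \<le> (z / (x + y)) powr p" if "0 \<le> z" "z \<le> x + y" for z
    using powr_mono'[of p 1 "z / (x + y)"] that pos assms by simp
  have "1 = x / (x + y) + y / (x + y)" using pos by (simp add: add_divide_distrib[symmetric])
  also have "\<dots> \<le> (x / (x + y)) powr p + (y / (x + y)) powr p"
    using assms by (intro add_mono le) auto
  also have "\<dots> = (x powr p + y powr p) / (x + y) powr p"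
    using assms pos by (simp add: powr_divide add_divide_distrib)
  finally show ?thesis using pos by (simp add: field_simps)
qed

lemma powr_midpoint_le:
  fixes u v p :: real
  assumes "0 \<le> u" "0 \<le> v" "1 \<le> p"
  shows "((u + v) / 2) powr p \<le> (u powr p + v powr p) / 2"
proof -
  have half: "(z / 2) powr p \<le> z powr p / 2" if "0 \<le> z" for z :: real
  proof -
    have "2 powr 1 \<le> (2::real) powr p" using assms by (intro powr_mono) auto
    then have "z powr p / 2 powr p \<le> z powr p / 2"
      by (intro divide_left_mono) auto
    then show ?thesis using that by (simp add: powr_divide)
  qed
  consider "u = 0" | "v = 0" | "0 < u" "0 < v" using assms by linarith
  then show ?thesis
  proof cases
    case 3
    have "((1 - 1/2) *\<^sub>R u + (1/2) *\<^sub>R v) powr p \<le> (1 - 1/2) * u powr p + (1/2) * v powr p"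
      using 3 assms by (intro convex_onD[OF powr_convex]) auto
    then show ?thesis by (simp add: field_simps)
  qed (use half assms in auto)
qed

text \<open>\<open>\<bar>x\<bar>\<close> is at most the mean of \<open>\<bar>x + d\<bar>\<close> and
  \<open>\<bar>x - d\<bar>\<close>; monotonicity and midpoint convexity do the rest. With exponent
  \<open>2 * h\<close> this says that increments are nonnegatively correlated for
  \<open>h > 1/2\<close>.\<close>

lemma second_difference_powr_nonneg:
  fixes x d p :: real
  assumes "1 \<le> p"
  shows "2 * \<bar>x\<bar> powr p \<le> \<bar>x + d\<bar> powr p + \<bar>x - d\<bar> powr p"
proof -
  have "\<bar>x\<bar> powr p \<le> ((\<bar>x + d\<bar> + \<bar>x - d\<bar>) / 2) powr p"
    using assms by (intro powr_mono2) auto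
  also have "\<dots> \<le> (\<bar>x + d\<bar> powr p + \<bar>x - d\<bar> powr p) / 2"
    using assms by (intro powr_midpoint_le) auto
  finally show ?thesis by simp
qed

text \<open>Concavity is drawn from midpoint convexity for the exponent \<open>1 / p\<close>. The
  condition on \<open>d\<close> keeps \<open>x + d\<close> and \<open>x - d\<close> on one side of
  0, so that the mean of their absolute values is exactly \<open>\<bar>x\<bar>\<close>.\<close>

lemma second_difference_powr_nonpos:
  fixes x d p :: real
  assumes p: "0 < p" "p \<le> 1" and x: "\<bar>d\<bar> \<le> \<bar>x\<bar>"
  shows "\<bar>x + d\<bar> powr p + \<bar>x - d\<bar> powr p \<le> 2 * \<bar>x\<bar> powr p"
proof -
  let ?a = "\<bar>x + d\<bar> powr p" and ?b = "\<bar>x - d\<bar> powr p"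
  have "((?a + ?b) / 2) powr (1 / p) \<le> (?a powr (1 / p) + ?b powr (1 / p)) / 2"
    using p by (intro powr_midpoint_le) auto
  also have "\<dots> = \<bar>x\<bar>" using p x by (simp add: powr_powr abs_if split: if_splits)
  finally have "(((?a + ?b) / 2) powr (1 / p)) powr p \<le> \<bar>x\<bar> powr p"
    using p by (intro powr_mono2) auto
  then show ?thesis using p by (simp add: powr_powr)
qed

text \<open>The odd power function. Being monotone, it has differences of constant sign, which can
  be summed by telescoping; this fails for the even power.\<close>

definition signed_powr :: "real \<Rightarrow> real \<Rightarrow> real" where
  "signed_powr p x = sgn x * \<bar>x\<bar> powr p"

lemma signed_powr_nonneg: "0 \<le> x \<Longrightarrow> signed_powr p x = x powr p"
  by (cases "x = 0") (auto simp: signed_powr_def)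

lemma signed_powr_minus: "signed_powr p (- x) = - signed_powr p x"
  by (simp add: signed_powr_def sgn_minus)

lemma signed_powr_nonpos: "x \<le> 0 \<Longrightarrow> signed_powr p x = - ((- x) powr p)"
  using signed_powr_nonneg[of "- x" p] by (simp add: signed_powr_minus)

lemma signed_powr_mono:
  assumes "x \<le> y" "0 < p"
  shows "signed_powr p x \<le> signed_powr p y"
proof -
  consider "0 \<le> x" | "x \<le> 0" "0 \<le> y" | "y \<le> 0" by linarith
  then show ?thesis
  proof cases
    case 1
    then show ?thesis using assms by (simp add: signed_powr_nonneg powr_mono2)
  next
    case 2
    then show ?thesis
      by (simp add: signed_powr_nonneg signed_powr_nonpos)
        (meson neg_le_0_iff_le order_trans powr_ge_zero)
  next
    case 3
    then show ?thesis using assms by (simp add: signed_powr_nonpos powr_mono2)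
  qed
qed

text \<open>On either side of 0 this is subadditivity of the power. The factor 2 covers arguments on
  opposite sides, where each of the two powers is at most
  \<open>\<bar>x - y\<bar> powr p\<close>.\<close>

lemma signed_powr_holder:
  assumes p: "0 < p" "p \<le> 1"
  shows "\<bar>signed_powr p x - signed_powr p y\<bar> \<le> 2 * \<bar>x - y\<bar> powr p"
proof -
  have pos: "b powr p - a powr p \<le> 2 * (b - a) powr p" if "0 \<le> a" "a \<le> b" for a b :: real
  proof -
    have "b powr p \<le> a powr p + (b - a) powr p"
      using powr_add_le[of a "b - a" p] that p by simp
    then show ?thesis using powr_ge_zero[of "b - a" p] by linarith
  qed
  have main: "signed_powr p y - signed_powr p x \<le> 2 * (y - x) powr p" if xy: "x \<le> y" for x y
  proof -
    consider "0 \<le> x" | "x \<le> 0" "0 \<le> y" | "y \<le> 0" by linarith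
    then show ?thesis
    proof cases
      case 1
      then show ?thesis using pos[of x y] xy by (simp add: signed_powr_nonneg)
    next
      case 2
      have "y powr p \<le> (y - x) powr p" "(- x) powr p \<le> (y - x) powr p"
        using 2 p by (intro powr_mono2; simp)+
      then show ?thesis using 2 by (simp add: signed_powr_nonneg signed_powr_nonpos)
    next
      case 3
      then show ?thesis using pos[of "- y" "- x"] xy by (simp add: signed_powr_nonpos)
    qed
  qed
  show ?thesis
  proof (cases "x \<le> y")
    case True
    then show ?thesis using main[OF True] signed_powr_mono[OF True p(1)] by simp
  next
    case False
    then have "y \<le> x" by simp
    then show ?thesis using main[of y x] signed_powr_mono[of y x p] p by simp
  qed
qed

definition cross_kernel :: "real \<Rightarrow> real \<Rightarrow> real \<Rightarrow> real \<Rightarrow> real" where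
  "cross_kernel \<rho> e p x = (\<rho> - sign01 x * e) * \<bar>x\<bar> powr p"

text \<open>The decomposition into an even part with coefficient \<rho> and an odd part with
  coefficient \<open>e\<close>; at \<open>x = 0\<close> both sides vanish.\<close>

lemma cross_kernel_altdef: "cross_kernel \<rho> e p x = \<rho> * \<bar>x\<bar> powr p - e * signed_powr p x"
  by (cases "x = 0")
    (auto simp: cross_kernel_def sign01_def signed_powr_nonneg signed_powr_nonpos algebra_simps)

text \<open>The even power is the absolute value of the odd one, so the reverse triangle inequality
  controls both parts by differences of the monotone function \<open>signed_powr p\<close>.\<close>

lemma cross_kernel_diff_le:
  assumes p: "0 < p"
  shows "\<bar>cross_kernel \<rho> e p x - cross_kernel \<rho> e p y\<bar>
           \<le> (\<bar>\<rho>\<bar> + \<bar>e\<bar>) * \<bar>signed_powr p x - signed_powr p y\<bar>"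
proof -
  have ev: "\<bar>x\<bar> powr p = \<bar>signed_powr p x\<bar>" for x
    by (cases "x = 0") (auto simp: signed_powr_def abs_mult abs_sgn_eq)
  have "cross_kernel \<rho> e p x - cross_kernel \<rho> e p y =
      \<rho> * (\<bar>signed_powr p x\<bar> - \<bar>signed_powr p y\<bar>) - e * (signed_powr p x - signed_powr p y)"
    by (simp add: cross_kernel_altdef ev algebra_simps)
  also have "\<bar>\<dots>\<bar> \<le> \<bar>\<rho>\<bar> * \<bar>\<bar>signed_powr p x\<bar> - \<bar>signed_powr p y\<bar>\<bar>
                    + \<bar>e\<bar> * \<bar>signed_powr p x - signed_powr p y\<bar>"
    by (intro order_trans[OF abs_triangle_ineq4]) (simp add: abs_mult)
  also have "\<dots> \<le> \<bar>\<rho>\<bar> * \<bar>signed_powr p x - signed_powr p y\<bar>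
                    + \<bar>e\<bar> * \<bar>signed_powr p x - signed_powr p y\<bar>"
    by (intro add_mono mult_left_mono) (auto simp: abs_triangle_ineq3)
  finally show ?thesis by (simp add: algebra_simps)
qed

lemma cross_kernel_holder:
  assumes "0 < p" "p \<le> 1"
  shows "\<bar>cross_kernel \<rho> e p x - cross_kernel \<rho> e p y\<bar> \<le> 2 * (\<bar>\<rho>\<bar> + \<bar>e\<bar>) * \<bar>x - y\<bar> powr p"
proof -
  have "(\<bar>\<rho>\<bar> + \<bar>e\<bar>) * \<bar>signed_powr p x - signed_powr p y\<bar> \<le> (\<bar>\<rho>\<bar> + \<bar>e\<bar>) * (2 * \<bar>x - y\<bar> powr p)"
    using assms by (intro mult_left_mono signed_powr_holder) auto
  then show ?thesis using cross_kernel_diff_le[OF assms(1), of \<rho> e x y]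
    by (simp only: mult.assoc mult.left_commute[of _ 2])
qed

text \<open>A centred difference is the sum of two adjacent forward differences. Each telescopes in
  \<open>l\<close>, leaving four boundary values at arguments of modulus at most
  \<open>n * D\<close>.\<close>

lemma sum_signed_powr_telescope:
  assumes D: "0 < D" and p: "0 < p" and k: "k < n"
  shows "(\<Sum>l<n. signed_powr p ((real l - real k) * D + D) - signed_powr p ((real l - real k) * D - D))
           \<le> 4 * (real n * D) powr p"
proof -
  let ?v = "\<lambda>l::nat. signed_powr p ((real l - real k) * D)"
  have eq: "signed_powr p ((real l - real k) * D + D) - signed_powr p ((real l - real k) * D - D)
      = (?v (Suc l) - ?v l) + (signed_powr p ((real (Suc l) - 1 - real k) * D)
          - signed_powr p ((real l - 1 - real k) * D))" for l
    by (simp add: algebra_simps)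
  have "(\<Sum>l<n. signed_powr p ((real l - real k) * D + D) - signed_powr p ((real l - real k) * D - D))
      = (?v n - ?v 0) + (signed_powr p ((real n - 1 - real k) * D) - signed_powr p ((0 - 1 - real k) * D))"
    unfolding eq sum.distrib
    using sum_lessThan_telescope[of ?v n]
      sum_lessThan_telescope[of "\<lambda>l. signed_powr p ((real l - 1 - real k) * D)" n] by simp
  also have "\<dots> = ((real n - real k) * D) powr p + (real k * D) powr p
      + ((real n - 1 - real k) * D) powr p + ((1 + real k) * D) powr p"
  proof -
    have "(0 - 1 - real k) * D = - ((1 + real k) * D)" "(real 0 - real k) * D = - (real k * D)"
      by (simp_all add: algebra_simps)
    moreover have "signed_powr p ((real n - real k) * D) = ((real n - real k) * D) powr p"
      "signed_powr p (real k * D) = (real k * D) powr p"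
      "signed_powr p ((real n - 1 - real k) * D) = ((real n - 1 - real k) * D) powr p"
      "signed_powr p ((1 + real k) * D) = ((1 + real k) * D) powr p"
      using D k by (intro signed_powr_nonneg mult_nonneg_nonneg; simp)+
    ultimately show ?thesis by (simp only: signed_powr_minus)
  qed
  also have "\<dots> \<le> (real n * D) powr p + (real n * D) powr p + (real n * D) powr p + (real n * D) powr p"
    using D p k by (intro add_mono powr_mono2 mult_right_mono) auto
  finally show ?thesis by simp
qed

section \<open>Gaussian spaces and Isserlis' formula\<close>

text \<open>Apart from measurability, this fourth moment identity is all that is used about Gaussian
  laws; Isserlis' formula follows from it by polarization.\<close>

lemma (in prob_space) gaussian_rv_moments:
  assumes X: "gaussian_rv M X" and X0: "expectation X = 0"
  shows "integrable M (\<lambda>\<omega>. X \<omega> ^ 4)"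
    and "expectation (\<lambda>\<omega>. X \<omega> ^ 4) = 3 * (expectation (\<lambda>\<omega>. X \<omega> ^ 2))\<^sup>2"
proof -
  have Xm[measurable]: "X \<in> borel_measurable M" using X by (simp add: gaussian_rv_def)
  have "integrable M (\<lambda>\<omega>. X \<omega> ^ 4) \<and>
    expectation (\<lambda>\<omega>. X \<omega> ^ 4) = 3 * (expectation (\<lambda>\<omega>. X \<omega> ^ 2))\<^sup>2"
  proof (cases "\<exists>m. AE \<omega> in M. X \<omega> = m")
    case True
    then obtain m where m: "AE \<omega> in M. X \<omega> = m" by blast
    have "expectation X = expectation (\<lambda>_. m)" by (intro integral_cong_AE) (use m in auto)
    then have "m = 0" using X0 by (simp add: prob_space)
    then have z: "AE \<omega> in M. X \<omega> = 0" using m by simp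
    have e4: "AE \<omega> in M. X \<omega> ^ 4 = 0" and e2: "AE \<omega> in M. X \<omega> ^ 2 = 0" using z by auto
    have "integrable M (\<lambda>\<omega>. X \<omega> ^ 4) \<longleftrightarrow> integrable M (\<lambda>_. 0::real)"
      by (intro integrable_cong_AE) (use e4 in auto)
    moreover have "expectation (\<lambda>\<omega>. X \<omega> ^ 4) = expectation (\<lambda>_. 0)"
      by (intro integral_cong_AE) (use e4 in auto)
    moreover have "expectation (\<lambda>\<omega>. X \<omega> ^ 2) = expectation (\<lambda>_. 0)"
      by (intro integral_cong_AE) (use e2 in auto)
    ultimately show ?thesis by simp
  next
    case False
    then obtain m s where s: "0 < s" and d: "distributed M lborel X (\<lambda>x. ennreal (normal_density m s x))"
      using X unfolding gaussian_rv_def by blast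
    have m: "m = 0" using normal_distributed_expectation[OF s d] X0 by simp
    have b2: "has_bochner_integral lborel (\<lambda>x. normal_density 0 s x * x ^ 2) (s\<^sup>2)"
    proof -
      have "fact (2 * 1) / ((2 / s\<^sup>2) ^ 1 * fact 1) = s\<^sup>2"
        using s by simp
      from normal_moment_even[OF s, of 0 1, unfolded this] show ?thesis
        by (simp only: diff_zero mult_1_right)
    qed
    have b4: "has_bochner_integral lborel (\<lambda>x. normal_density 0 s x * x ^ 4) (3 * s ^ 4)"
      using normal_moment_even[OF s, of 0 2] s
      by (simp add: fact_numeral field_simps power2_eq_square eval_nat_numeral)
    have "integrable M (\<lambda>\<omega>. X \<omega> ^ 4)"
      using distributed_integrable[OF d, of "\<lambda>x. x ^ 4"] b4 m
      by (auto simp: has_bochner_integral_iff)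
    moreover have "expectation (\<lambda>\<omega>. X \<omega> ^ 4) = 3 * s ^ 4"
      using distributed_integral[OF d, of "\<lambda>x. x ^ 4"] b4 m
      by (auto simp: has_bochner_integral_iff)
    moreover have "expectation (\<lambda>\<omega>. X \<omega> ^ 2) = s\<^sup>2"
      using distributed_integral[OF d, of "\<lambda>x. x ^ 2"] b2 m
      by (auto simp: has_bochner_integral_iff)
    ultimately show ?thesis by simp
  qed
  then show "integrable M (\<lambda>\<omega>. X \<omega> ^ 4)"
    and "expectation (\<lambda>\<omega>. X \<omega> ^ 4) = 3 * (expectation (\<lambda>\<omega>. X \<omega> ^ 2))\<^sup>2" by auto
qed

text \<open>Linear closure is asked for, not closure in mean square: the Riemann sums lie in
  \<open>G\<close>, while their limits need not.\<close>

locale centered_gaussian_space = prob_space M for M :: "'w measure" +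
  fixes G :: "('w \<Rightarrow> real) set"
  assumes gaussian: "X \<in> G \<Longrightarrow> gaussian_rv M X"
    and centered: "X \<in> G \<Longrightarrow> expectation X = 0"
    and zero_mem: "(\<lambda>\<omega>. 0) \<in> G"
    and add_mem: "X \<in> G \<Longrightarrow> Y \<in> G \<Longrightarrow> (\<lambda>\<omega>. X \<omega> + Y \<omega>) \<in> G"
    and scale_mem: "X \<in> G \<Longrightarrow> (\<lambda>\<omega>. c * X \<omega>) \<in> G"
begin

lemma diff_mem: "X \<in> G \<Longrightarrow> Y \<in> G \<Longrightarrow> (\<lambda>\<omega>. X \<omega> - Y \<omega>) \<in> G"
  using add_mem[of X "\<lambda>\<omega>. - 1 * Y \<omega>"] scale_mem[of Y "- 1"] by simp

lemma sum_mem: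
  assumes "\<And>i. i \<in> I \<Longrightarrow> X i \<in> G"
  shows "(\<lambda>\<omega>. \<Sum>i\<in>I. X i \<omega>) \<in> G"
  using assms by (induction I rule: infinite_finite_induct) (auto intro: zero_mem add_mem)

lemma measurable_mem [measurable_dest]: "X \<in> G \<Longrightarrow> X \<in> borel_measurable M"
  using gaussian by (simp add: gaussian_rv_def)

lemma integrable_mult4:
  assumes "X \<in> G" "Y \<in> G" "Z \<in> G" "W \<in> G"
  shows "integrable M (\<lambda>\<omega>. X \<omega> * Y \<omega> * Z \<omega> * W \<omega>)"
proof (rule Bochner_Integration.integrable_bound)
  show "integrable M (\<lambda>\<omega>. X \<omega> ^ 4 + Y \<omega> ^ 4 + Z \<omega> ^ 4 + W \<omega> ^ 4)"
    using assms by (intro Bochner_Integration.integrable_add gaussian_rv_moments gaussian centered)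
  show "(\<lambda>\<omega>. X \<omega> * Y \<omega> * Z \<omega> * W \<omega>) \<in> borel_measurable M"
    using assms by measurable
  have amgm: "2 * (a * b) \<le> a\<^sup>2 + b\<^sup>2" for a b :: real
    using sum_squares_bound[of a b] by simp
  have "norm (x * y * z * w) \<le> norm (x ^ 4 + y ^ 4 + z ^ 4 + w ^ 4)" for x y z w :: real
  proof -
    have "2 * (\<bar>x * y\<bar> * \<bar>z * w\<bar>) \<le> (x * y)\<^sup>2 + (z * w)\<^sup>2"
      using amgm[of "\<bar>x * y\<bar>" "\<bar>z * w\<bar>"] by simp
    moreover have "2 * (x * y)\<^sup>2 \<le> x ^ 4 + y ^ 4" for x y :: real
      using amgm[of "x\<^sup>2" "y\<^sup>2"] by (simp add: power_mult_distrib power_mult[symmetric])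
    ultimately have "4 * (\<bar>x * y\<bar> * \<bar>z * w\<bar>) \<le> x ^ 4 + y ^ 4 + z ^ 4 + w ^ 4"
      by (smt (verit, best))
    moreover have "0 \<le> \<bar>x * y\<bar> * \<bar>z * w\<bar>" by simp
    moreover have "\<bar>x * y * z * w\<bar> = \<bar>x * y\<bar> * \<bar>z * w\<bar>" by (simp add: abs_mult mult.assoc)
    ultimately show ?thesis unfolding real_norm_def by linarith
  qed
  then show "AE \<omega> in M. norm (X \<omega> * Y \<omega> * Z \<omega> * W \<omega>) \<le> norm (X \<omega> ^ 4 + Y \<omega> ^ 4 + Z \<omega> ^ 4 + W \<omega> ^ 4)"
    by (intro AE_I2)
qed

lemma integrable_mult:
  assumes "X \<in> G" "Y \<in> G"
  shows "integrable M (\<lambda>\<omega>. X \<omega> * Y \<omega>)"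
proof (rule Bochner_Integration.integrable_bound)
  show "integrable M (\<lambda>\<omega>. 1 + X \<omega> * Y \<omega> * X \<omega> * Y \<omega>)"
    using assms by (intro Bochner_Integration.integrable_add integrable_mult4) auto
  show "(\<lambda>\<omega>. X \<omega> * Y \<omega>) \<in> borel_measurable M"
    using assms by measurable
  have "norm (x * y) \<le> norm (1 + x * y * x * y)" for x y :: real
  proof -
    have "2 * \<bar>x * y\<bar> \<le> 1 + (x * y)\<^sup>2"
      using sum_squares_bound[of 1 "\<bar>x * y\<bar>"] by simp
    moreover have "x * y * x * y = (x * y)\<^sup>2" by (simp add: power2_eq_square)
    ultimately show ?thesis unfolding real_norm_def by linarith
  qed
  then show "AE \<omega> in M. norm (X \<omega> * Y \<omega>) \<le> norm (1 + X \<omega> * Y \<omega> * X \<omega> * Y \<omega>)"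
    by (intro AE_I2)
qed

lemma integrable_square_mult:
  "X \<in> G \<Longrightarrow> Y \<in> G \<Longrightarrow> integrable M (\<lambda>\<omega>. (X \<omega> * Y \<omega>)\<^sup>2)"
  using integrable_mult4[of X Y X Y] by (simp add: power2_eq_square mult.assoc)

text \<open>The covariance, since the members of \<open>G\<close> are centred.\<close>

definition cov :: "('w \<Rightarrow> real) \<Rightarrow> ('w \<Rightarrow> real) \<Rightarrow> real" where
  "cov X Y = expectation (\<lambda>\<omega>. X \<omega> * Y \<omega>)"

lemma cov_commute: "cov X Y = cov Y X"
  by (simp add: cov_def mult.commute)

lemma cov_self: "cov X X = expectation (\<lambda>\<omega>. (X \<omega>)\<^sup>2)"
  by (simp add: cov_def power2_eq_square)

lemma cov_self_nonneg [simp]: "0 \<le> cov X X"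
  by (simp add: cov_self)

lemma cov_add_left:
  assumes "X \<in> G" "Y \<in> G" "Z \<in> G"
  shows "cov (\<lambda>\<omega>. X \<omega> + Y \<omega>) Z = cov X Z + cov Y Z"
  using assms by (simp add: cov_def distrib_right integrable_mult)

lemma cov_diff_left:
  assumes "X \<in> G" "Y \<in> G" "Z \<in> G"
  shows "cov (\<lambda>\<omega>. X \<omega> - Y \<omega>) Z = cov X Z - cov Y Z"
  using assms by (simp add: cov_def left_diff_distrib integrable_mult)

lemma cov_scale_left: "cov (\<lambda>\<omega>. c * X \<omega>) Z = c * cov X Z"
  by (simp add: cov_def mult.assoc)

lemma cov_add_right:
  "X \<in> G \<Longrightarrow> Y \<in> G \<Longrightarrow> Z \<in> G \<Longrightarrow> cov Z (\<lambda>\<omega>. X \<omega> + Y \<omega>) = cov Z X + cov Z Y"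
  by (subst (1 2 3) cov_commute) (rule cov_add_left)

lemma cov_diff_right:
  "X \<in> G \<Longrightarrow> Y \<in> G \<Longrightarrow> Z \<in> G \<Longrightarrow> cov Z (\<lambda>\<omega>. X \<omega> - Y \<omega>) = cov Z X - cov Z Y"
  by (subst (1 2 3) cov_commute) (rule cov_diff_left)

lemma cov_scale_right: "cov Z (\<lambda>\<omega>. c * X \<omega>) = c * cov Z X"
  by (subst (1 2) cov_commute) (rule cov_scale_left)

lemma cov_sum_left:
  assumes "\<And>i. i \<in> I \<Longrightarrow> X i \<in> G" "Z \<in> G"
  shows "cov (\<lambda>\<omega>. \<Sum>i\<in>I. X i \<omega>) Z = (\<Sum>i\<in>I. cov (X i) Z)"
  using assms by (simp add: cov_def sum_distrib_right integrable_mult)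

lemma cov_sum_right:
  assumes "\<And>i. i \<in> I \<Longrightarrow> X i \<in> G" "Z \<in> G"
  shows "cov Z (\<lambda>\<omega>. \<Sum>i\<in>I. X i \<omega>) = (\<Sum>i\<in>I. cov Z (X i))"
  using assms by (simp add: cov_commute[of Z] cov_sum_left)

lemma cov_square_le:
  assumes XY: "X \<in> G" "Y \<in> G"
  shows "(cov X Y)\<^sup>2 \<le> cov X X * cov Y Y"
proof -
  have quad: "0 \<le> b\<^sup>2 * cov X X - 2 * (b * c) * cov X Y + c\<^sup>2 * cov Y Y" for b c
  proof -
    have "cov (\<lambda>\<omega>. b * X \<omega> - c * Y \<omega>) (\<lambda>\<omega>. b * X \<omega> - c * Y \<omega>)
        = b * (b * cov X X - c * cov X Y) - c * (b * cov X Y - c * cov Y Y)"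
      using XY by (simp add: cov_diff_left cov_diff_right cov_scale_left cov_scale_right
          diff_mem scale_mem cov_commute[of Y X])
    also have "\<dots> = b\<^sup>2 * cov X X - 2 * (b * c) * cov X Y + c\<^sup>2 * cov Y Y" by algebra
    finally show ?thesis using cov_self_nonneg[of "\<lambda>\<omega>. b * X \<omega> - c * Y \<omega>"] by simp
  qed
  show ?thesis
  proof (cases "cov Y Y = 0")
    case True
    have "cov X Y = 0"
    proof (rule ccontr)
      assume n: "cov X Y \<noteq> 0"
      \<comment> \<open>The coefficient is chosen so that the right side equals
        \<open>- 1\<close>.\<close>
      have "0 \<le> cov X X - 2 * ((cov X X + 1) / (2 * cov X Y)) * cov X Y"
        using quad[of 1 "(cov X X + 1) / (2 * cov X Y)"] True by simp
      then show False using n by simp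
    qed
    then show ?thesis by (simp add: True)
  next
    case False
    then have pos: "0 < cov Y Y" using cov_self_nonneg[of Y] by linarith
    have "0 \<le> cov Y Y * (cov X X * cov Y Y - (cov X Y)\<^sup>2)"
      using quad[of "cov Y Y" "cov X Y"] by (simp add: power2_eq_square algebra_simps)
    then show ?thesis using pos by (simp add: zero_le_mult_iff)
  qed
qed

lemma cov_le:
  assumes "X \<in> G" "Y \<in> G" "cov X X \<le> a\<^sup>2" "cov Y Y \<le> b\<^sup>2" "0 \<le> a" "0 \<le> b"
  shows "\<bar>cov X Y\<bar> \<le> a * b"
proof -
  have "(cov X Y)\<^sup>2 \<le> a\<^sup>2 * b\<^sup>2"
    using cov_square_le[OF assms(1,2)] mult_mono[OF assms(3,4)] by simp
  then have "\<bar>cov X Y\<bar>\<^sup>2 \<le> (a * b)\<^sup>2" by (simp add: power_mult_distrib)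
  then show ?thesis
    by (rule power2_le_imp_le) (use assms(5,6) in simp)
qed

lemma expectation_power4:
  "X \<in> G \<Longrightarrow> expectation (\<lambda>\<omega>. X \<omega> ^ 4) = 3 * (cov X X)\<^sup>2"
  using gaussian_rv_moments(2)[OF gaussian[of X] centered[of X]] by (simp add: cov_self)

text \<open>Here \<open>s\<close> stands for the sum of the four variances and the other letters for
  the covariances, so each bracket is the variance of a signed sum of \<open>X\<close>,
  \<open>Y\<close>, \<open>Z\<close>, \<open>W\<close>. The signs have product 1 in the first four
  brackets and \<open>- 1\<close> in the last four.\<close>

lemma polarization_of_squares:
  fixes s xy xz xw yz yw zw :: real
  shows "((s + 2 * (xy + xz + xw + yz + yw + zw))\<^sup>2 + (s + 2 * (xy - xz - xw - yz - yw + zw))\<^sup>2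
        + (s + 2 * (- xy + xz - xw - yz + yw - zw))\<^sup>2 + (s + 2 * (- xy - xz + xw + yz - yw - zw))\<^sup>2)
       - ((s + 2 * (xy + xz - xw + yz - yw - zw))\<^sup>2 + (s + 2 * (xy - xz + xw - yz + yw - zw))\<^sup>2
        + (s + 2 * (- xy + xz + xw - yz - yw + zw))\<^sup>2 + (s + 2 * (- xy - xz - xw + yz + yw + zw))\<^sup>2)
       = 64 * (xy * zw + xz * yw + xw * yz)"
  by algebra

text \<open>Polarization of \<open>E U^4 = 3 (E U^2)^2\<close> over the sums \<open>X \<plusminus> Y \<plusminus> Z \<plusminus> W\<close>.\<close>

lemma isserlis:
  assumes G: "X \<in> G" "Y \<in> G" "Z \<in> G" "W \<in> G"
  shows "expectation (\<lambda>\<omega>. X \<omega> * Y \<omega> * Z \<omega> * W \<omega>) =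
           cov X Y * cov Z W + cov X Z * cov Y W + cov X W * cov Y Z"
proof -
  define U where "U b c d \<omega> = X \<omega> + (b * Y \<omega> + (c * Z \<omega> + d * W \<omega>))" for b c d \<omega>
  have UG: "U b c d \<in> G" for b c d
    unfolding U_def[abs_def] using G by (intro add_mem scale_mem)
  have covU: "cov (U b c d) (U b c d) = cov X X + b\<^sup>2 * cov Y Y + c\<^sup>2 * cov Z Z + d\<^sup>2 * cov W W
      + 2 * (b * cov X Y + c * cov X Z + d * cov X W + b * c * cov Y Z + b * d * cov Y W + c * d * cov Z W)"
    for b c d
    unfolding U_def[abs_def] using G
    by (simp add: cov_add_left cov_add_right cov_scale_left cov_scale_right add_mem scale_mem
        cov_commute[of Y X] cov_commute[of Z X] cov_commute[of W X] cov_commute[of Z Y]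
        cov_commute[of W Y] cov_commute[of W Z] power2_eq_square algebra_simps)
  have U4: "integrable M (\<lambda>\<omega>. U b c d \<omega> ^ 4)"
      "expectation (\<lambda>\<omega>. U b c d \<omega> ^ 4) = 3 * (cov (U b c d) (U b c d))\<^sup>2" for b c d
    by (intro gaussian_rv_moments(1) gaussian centered UG, intro expectation_power4 UG)
  \<comment> \<open>\<open>192 = 8 * 24\<close>: eight sign patterns, and \<open>XYZW\<close> has
    multinomial coefficient 24 in a fourth power. All other monomials cancel.\<close>
  have pol: "192 * (X \<omega> * Y \<omega> * Z \<omega> * W \<omega>) =
      (U 1 1 1 \<omega> ^ 4 + U 1 (-1) (-1) \<omega> ^ 4 + U (-1) 1 (-1) \<omega> ^ 4 + U (-1) (-1) 1 \<omega> ^ 4) -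
      (U 1 1 (-1) \<omega> ^ 4 + U 1 (-1) 1 \<omega> ^ 4 + U (-1) 1 1 \<omega> ^ 4 + U (-1) (-1) (-1) \<omega> ^ 4)" for \<omega>
    unfolding U_def by algebra
  have "192 * expectation (\<lambda>\<omega>. X \<omega> * Y \<omega> * Z \<omega> * W \<omega>) =
      expectation (\<lambda>\<omega>. 192 * (X \<omega> * Y \<omega> * Z \<omega> * W \<omega>))" by simp
  also have "\<dots> =
      (3 * (cov (U 1 1 1) (U 1 1 1))\<^sup>2 + 3 * (cov (U 1 (-1) (-1)) (U 1 (-1) (-1)))\<^sup>2
       + 3 * (cov (U (-1) 1 (-1)) (U (-1) 1 (-1)))\<^sup>2 + 3 * (cov (U (-1) (-1) 1) (U (-1) (-1) 1))\<^sup>2) -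
      (3 * (cov (U 1 1 (-1)) (U 1 1 (-1)))\<^sup>2 + 3 * (cov (U 1 (-1) 1) (U 1 (-1) 1))\<^sup>2
       + 3 * (cov (U (-1) 1 1) (U (-1) 1 1))\<^sup>2 + 3 * (cov (U (-1) (-1) (-1)) (U (-1) (-1) (-1)))\<^sup>2)"
    unfolding pol by (simp add: U4)
  also have "\<dots> = 3 * (64 * (cov X Y * cov Z W + cov X Z * cov Y W + cov X W * cov Y Z))"
    unfolding polarization_of_squares[of "cov X X + cov Y Y + cov Z Z + cov W W", symmetric] covU
    by simp
  finally show ?thesis by simp
qed

lemma expectation_square_mult_le:
  assumes G: "X \<in> G" "Y \<in> G"
  shows "expectation (\<lambda>\<omega>. (X \<omega> * Y \<omega>)\<^sup>2) \<le> 3 * (cov X X * cov Y Y)"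
proof -
  have "expectation (\<lambda>\<omega>. (X \<omega> * Y \<omega>)\<^sup>2) = expectation (\<lambda>\<omega>. X \<omega> * Y \<omega> * X \<omega> * Y \<omega>)"
    by (simp add: power2_eq_square mult.assoc)
  also have "\<dots> = cov X X * cov Y Y + 2 * (cov X Y)\<^sup>2"
    using isserlis[of X Y X Y] G by (simp add: cov_commute[of Y X] power2_eq_square)
  finally show ?thesis using cov_square_le[OF G] by simp
qed

lemma exp_filter_mem:
  assumes "\<And>u. X u \<in> G"
  shows "(\<lambda>\<omega>. exp_filter a h m (\<lambda>u. X u \<omega>) t) \<in> G"
  unfolding exp_filter_def using assms by (intro sum_mem scale_mem diff_mem)

lemma cov_exp_filter:
  assumes "\<And>u. X u \<in> G" "Z \<in> G"
  shows "cov Z (\<lambda>\<omega>. exp_filter a h m (\<lambda>u. X u \<omega>) t) = exp_filter a h m (\<lambda>u. cov Z (X u)) t"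
  unfolding exp_filter_def using assms
  by (subst cov_sum_right) (auto intro!: scale_mem diff_mem sum.cong simp: cov_scale_right cov_diff_right)

end

lemma centered_gaussian_space_lincombs:
  assumes M: "prob_space M" and X: "centered_gaussian_process M I X"
  shows "centered_gaussian_space M {Z. \<exists>J c. finite J \<and> J \<subseteq> I \<and> Z = (\<lambda>\<omega>. \<Sum>i\<in>J. c i * X i \<omega>)}"
    (is "centered_gaussian_space M ?G")
proof -
  interpret prob_space M by fact
  have single: "gaussian_rv M (X i)" "expectation (X i) = 0" if "i \<in> I" for i
  proof -
    have "\<forall>J c. finite J \<and> J \<subseteq> I \<longrightarrow> gaussian_rv M (\<lambda>\<omega>. \<Sum>i\<in>J. c i * X i \<omega>)"
      using X by (simp add: centered_gaussian_process_def gaussian_process_def)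
    from this[rule_format, of "{i}" "\<lambda>_. 1"] that
    show "gaussian_rv M (X i)" by simp
    show "expectation (X i) = 0" using X that by (simp add: centered_gaussian_process_def)
  qed
  \<comment> \<open>An integral equal to 0 does not certify integrability of \<open>X i\<close>; the
    fourth moment does.\<close>
  have int: "integrable M (X i)" if "i \<in> I" for i
  proof -
    have [measurable]: "X i \<in> borel_measurable M" using single[OF that] by (simp add: gaussian_rv_def)
    have le: "\<bar>x\<bar> \<le> \<bar>1 + x ^ 4\<bar>" for x :: real
    proof -
      have "2 * \<bar>x\<bar> \<le> 1 + x\<^sup>2" using sum_squares_bound[of 1 "\<bar>x\<bar>"] by simp
      moreover have "2 * x\<^sup>2 \<le> 1 + x ^ 4" using sum_squares_bound[of 1 "x\<^sup>2"] by simp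
      moreover have "0 \<le> x ^ 4" by simp
      ultimately show ?thesis by linarith
    qed
    show ?thesis
    proof (rule Bochner_Integration.integrable_bound)
      show "integrable M (\<lambda>\<omega>. 1 + X i \<omega> ^ 4)"
        by (intro Bochner_Integration.integrable_add integrable_const gaussian_rv_moments(1) single that)
      show "AE \<omega> in M. norm (X i \<omega>) \<le> norm (1 + X i \<omega> ^ 4)"
        unfolding real_norm_def by (intro AE_I2 le)
    qed measurable
  qed
  have GI: "(\<lambda>\<omega>. \<Sum>i\<in>J. c i * X i \<omega>) \<in> ?G" if "finite J" "J \<subseteq> I" for J c
    by (rule CollectI, rule exI[of _ J], rule exI[of _ c]) (simp add: that)
  show ?thesis
  proof unfold_locales
    fix Z assume "Z \<in> ?G"
    then obtain J c where J: "finite J" "J \<subseteq> I" and Z: "Z = (\<lambda>\<omega>. \<Sum>i\<in>J. c i * X i \<omega>)"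
      by (elim CollectE exE conjE)
    have "\<forall>J c. finite J \<and> J \<subseteq> I \<longrightarrow> gaussian_rv M (\<lambda>\<omega>. \<Sum>i\<in>J. c i * X i \<omega>)"
      using X by (simp add: centered_gaussian_process_def gaussian_process_def)
    then show "gaussian_rv M Z" using J unfolding Z by simp
    have "expectation Z = (\<Sum>i\<in>J. c i * expectation (X i))"
      unfolding Z using int J by (subst Bochner_Integration.integral_sum) auto
    then show "expectation Z = 0" using single J by (auto intro!: sum.neutral)
    show "(\<lambda>\<omega>. c' * Z \<omega>) \<in> ?G" for c'
    proof -
      have "(\<lambda>\<omega>. c' * Z \<omega>) = (\<lambda>\<omega>. \<Sum>i\<in>J. (c' * c i) * X i \<omega>)"
        unfolding Z by (simp add: sum_distrib_left mult.assoc)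
      then show ?thesis using GI[OF J] by (simp only:)
    qed
    fix Z' assume "Z' \<in> ?G"
    then obtain J' c' where J': "finite J'" "J' \<subseteq> I" and Z': "Z' = (\<lambda>\<omega>. \<Sum>i\<in>J'. c' i * X i \<omega>)"
      by (elim CollectE exE conjE)
    have ext: "(\<Sum>i\<in>K. d i * X i \<omega>) = (\<Sum>i\<in>J \<union> J'. (if i \<in> K then d i else 0) * X i \<omega>)"
      if "K \<subseteq> J \<union> J'" for K d \<omega>
      using that J J' by (intro sum.mono_neutral_cong_left) auto
    have "(\<lambda>\<omega>. Z \<omega> + Z' \<omega>) =
        (\<lambda>\<omega>. \<Sum>i\<in>J \<union> J'. ((if i \<in> J then c i else 0) + (if i \<in> J' then c' i else 0)) * X i \<omega>)"
      unfolding Z Z' using ext[of J c] ext[of J' c'] by (simp add: distrib_right sum.distrib)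
    then show "(\<lambda>\<omega>. Z \<omega> + Z' \<omega>) \<in> ?G" using GI[of "J \<union> J'"] J J' by simp
  next
    show "(\<lambda>\<omega>. 0) \<in> ?G" using GI[of "{}"] by simp
  qed
qed

section \<open>Fractional Brownian motion\<close>

context centered_gaussian_space
begin

lemma integrable_sum_products_square:
  assumes "\<And>k. A k \<in> G" "\<And>k. S k \<in> G"
  shows "integrable M (\<lambda>\<omega>. ((\<Sum>k<n. A k \<omega> * S k \<omega>) + c)\<^sup>2)"
proof -
  have "((\<Sum>k<n. A k \<omega> * S k \<omega>) + c)\<^sup>2 =
      (\<Sum>k<n. \<Sum>l<n. A k \<omega> * S k \<omega> * A l \<omega> * S l \<omega>) + 2 * c * (\<Sum>k<n. A k \<omega> * S k \<omega>) + c\<^sup>2" for \<omega>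
    by (simp add: power2_sum) (simp add: power2_eq_square sum_product mult.assoc)
  then show ?thesis
    using assms by (simp add: integrable_mult4 integrable_mult)
qed

text \<open>Of the three pairings in Isserlis' formula, the one matching \<open>A k\<close> with
  \<open>S k\<close> and \<open>A l\<close> with \<open>S l\<close> factorizes into the squared mean
  and completes the square with \<open>c\<close>. The other two form the variance.\<close>

lemma expectation_sum_products_square:
  assumes G: "\<And>k. A k \<in> G" "\<And>k. S k \<in> G"
  shows "expectation (\<lambda>\<omega>. ((\<Sum>k<n. A k \<omega> * S k \<omega>) + c)\<^sup>2) =
     (\<Sum>k<n. \<Sum>l<n. cov (A k) (A l) * cov (S k) (S l) + cov (A k) (S l) * cov (A l) (S k))
     + ((\<Sum>k<n. cov (A k) (S k)) + c)\<^sup>2"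
proof -
  have eq: "((\<Sum>k<n. A k \<omega> * S k \<omega>) + c)\<^sup>2 =
      (\<Sum>k<n. \<Sum>l<n. A k \<omega> * S k \<omega> * A l \<omega> * S l \<omega>) + 2 * c * (\<Sum>k<n. A k \<omega> * S k \<omega>) + c\<^sup>2" for \<omega>
    by (simp add: power2_sum) (simp add: power2_eq_square sum_product mult.assoc)
  have "expectation (\<lambda>\<omega>. ((\<Sum>k<n. A k \<omega> * S k \<omega>) + c)\<^sup>2) =
      (\<Sum>k<n. \<Sum>l<n. expectation (\<lambda>\<omega>. A k \<omega> * S k \<omega> * A l \<omega> * S l \<omega>))
      + 2 * c * (\<Sum>k<n. cov (A k) (S k)) + c\<^sup>2"
    unfolding eq using G by (simp add: integrable_mult4 integrable_mult cov_def prob_space)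
  also have "(\<Sum>k<n. \<Sum>l<n. expectation (\<lambda>\<omega>. A k \<omega> * S k \<omega> * A l \<omega> * S l \<omega>)) =
      (\<Sum>k<n. \<Sum>l<n. cov (A k) (A l) * cov (S k) (S l) + cov (A k) (S l) * cov (A l) (S k))
      + (\<Sum>k<n. \<Sum>l<n. cov (A k) (S k) * cov (A l) (S l))"
    unfolding sum.distrib[symmetric] using G
    by (intro sum.cong refl) (simp add: isserlis cov_commute[of "S _" "A _"])
  also have "(\<Sum>k<n. \<Sum>l<n. cov (A k) (S k) * cov (A l) (S l)) = (\<Sum>k<n. cov (A k) (S k))\<^sup>2"
    by (simp add: power2_eq_square sum_product)
  finally show ?thesis by (simp add: power2_sum algebra_simps)
qed

end

section \<open>Increments of fractional Brownian motion and its filtered version\<close>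

definition increment :: "(real \<Rightarrow> 'w \<Rightarrow> real) \<Rightarrow> real \<Rightarrow> nat \<Rightarrow> 'w \<Rightarrow> real" where
  "increment X D k = (\<lambda>\<omega>. X (real k * D + D) \<omega> - X (real k * D) \<omega>)"

text \<open>The factor beside \<open>C * D\<close> in the Langevin estimate
  \<open>exp_filter_increment\<close>; it stays bounded as \<open>D\<close> tends to 0.\<close>

definition drift_const :: "real \<Rightarrow> real \<Rightarrow> real" where
  "drift_const a D = a * (1 + D) + (a + 1) * (1 + 1 / a)"

lemma drift_const_nonneg: "0 < a \<Longrightarrow> 0 < D \<Longrightarrow> 0 \<le> drift_const a D"
  by (simp add: drift_const_def)

text \<open>Testing a variable against itself bounds its variance by \<open>K\<close> times its own
  standard deviation; this lemma cancels that factor.\<close>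

lemma square_le_of_self_bound:
  fixes x K :: real
  assumes "0 \<le> x" "x \<le> sqrt x * K"
  shows "x \<le> K\<^sup>2"
proof (cases "x = 0")
  case False
  then have pos: "0 < sqrt x" using assms by simp
  have "sqrt x * sqrt x \<le> sqrt x * K" using assms by simp
  then have "sqrt x \<le> K" by (simp only: mult_le_cancel_left_pos[OF pos])
  then have "(sqrt x)\<^sup>2 \<le> K\<^sup>2" using pos by (intro power_mono) auto
  then show ?thesis using assms by simp
qed simp

locale gaussian_fbm = centered_gaussian_space M G
  for M :: "'w measure" and G +
  fixes X :: "real \<Rightarrow> 'w \<Rightarrow> real" and h :: real
  assumes hurst: "0 < h" "h < 1"
    and mem: "X t \<in> G"
    and cov_fbm: "cov (X t) (X s) =
      1 / 2 * (\<bar>t\<bar> powr (2 * h) + \<bar>s\<bar> powr (2 * h) - \<bar>t - s\<bar> powr (2 * h))"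
begin

lemma cov_increments:
  "cov (\<lambda>\<omega>. X t \<omega> - X s \<omega>) (\<lambda>\<omega>. X t' \<omega> - X s' \<omega>) =
     1 / 2 * (\<bar>t - s'\<bar> powr (2 * h) + \<bar>s - t'\<bar> powr (2 * h)
              - \<bar>t - t'\<bar> powr (2 * h) - \<bar>s - s'\<bar> powr (2 * h))"
  by (simp add: cov_diff_left cov_diff_right mem diff_mem cov_fbm field_simps)

lemma cov_increment_self:
  "cov (\<lambda>\<omega>. X t \<omega> - X s \<omega>) (\<lambda>\<omega>. X t \<omega> - X s \<omega>) = (\<bar>t - s\<bar> powr h)\<^sup>2"
proof -
  have "cov (\<lambda>\<omega>. X t \<omega> - X s \<omega>) (\<lambda>\<omega>. X t \<omega> - X s \<omega>) = \<bar>t - s\<bar> powr (2 * h)"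
    by (simp add: cov_increments abs_minus_commute)
  also have "\<dots> = (\<bar>t - s\<bar> powr h)\<^sup>2"
    by (simp add: power2_eq_square powr_add[symmetric])
  finally show ?thesis .
qed

lemma increment_mem: "increment X D k \<in> G"
  unfolding increment_def by (intro diff_mem mem)

text \<open>Testing against a fixed variable reduces mean square estimates to deterministic paths.\<close>

lemma holder_path_cov:
  assumes Z: "Z \<in> G" and a: "0 < a"
  shows "holder_path (\<lambda>u. cov Z (X u)) (sqrt (cov Z Z)) h a"
proof
  show "\<bar>cov Z (X t) - cov Z (X s)\<bar> \<le> sqrt (cov Z Z) * \<bar>t - s\<bar> powr h" for s t
    using cov_le[OF Z diff_mem[OF mem mem], of "sqrt (cov Z Z)" t s "\<bar>t - s\<bar> powr h"] Z
    by (simp add: cov_increment_self cov_diff_right mem)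
qed (use a hurst in auto)

text \<open>For the filtered variable \<open>Z\<close>, \<open>cov Z Z\<close> is the filter of the
  path \<open>u \<mapsto> cov Z (X u)\<close>, whose Hoelder constant is
  \<open>sqrt (cov Z Z)\<close>. The deterministic bound thus becomes a self-bound.\<close>

lemma cov_exp_filter_le:
  assumes "0 < a" "0 < \<epsilon>"
  shows "cov (\<lambda>\<omega>. exp_filter a \<epsilon> m (\<lambda>u. X u \<omega>) t) (\<lambda>\<omega>. exp_filter a \<epsilon> m (\<lambda>u. X u \<omega>) t)
           \<le> (1 + 1 / a)\<^sup>2"
proof -
  define Z where "Z = (\<lambda>\<omega>. exp_filter a \<epsilon> m (\<lambda>u. X u \<omega>) t)"
  have Z: "Z \<in> G" unfolding Z_def by (intro exp_filter_mem mem)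
  have "cov Z Z = exp_filter a \<epsilon> m (\<lambda>u. cov Z (X u)) t"
    by (subst (2) Z_def) (intro cov_exp_filter mem Z)
  also have "\<dots> \<le> sqrt (cov Z Z) * (1 + 1 / a)"
    using holder_path.exp_filter_bound[OF holder_path_cov[OF Z assms(1)] assms(2), of m t] by simp
  finally show ?thesis unfolding Z_def[symmetric] by (intro square_le_of_self_bound) simp
qed

text \<open>The same self-test for the residual \<open>R\<close> of the Langevin equation, which is
  linear in \<open>X\<close>.\<close>

lemma cov_exp_filter_increment_le:
  fixes t :: real
  assumes a: "0 < a" and D: "0 < D" and N: "0 < N" "\<epsilon> = D / real N" and L: "exp (- a * (real L * D)) \<le> D"
  defines "R \<equiv> (\<lambda>\<omega>. exp_filter a \<epsilon> (L * N) (\<lambda>u. X u \<omega>) (t + D)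
      - exp_filter a \<epsilon> (L * N) (\<lambda>u. X u \<omega>) t - (X (t + D) \<omega> - X t \<omega>))"
  shows "R \<in> G" and "cov R R \<le> (D * drift_const a D)\<^sup>2"
proof -
  show R: "R \<in> G" unfolding R_def by (intro diff_mem exp_filter_mem mem)
  let ?P = "\<lambda>s. exp_filter a \<epsilon> (L * N) (\<lambda>u. cov R (X u)) s"
  have "cov R R = ?P (t + D) - ?P t - (cov R (X (t + D)) - cov R (X t))"
    by (subst (2) R_def) (simp add: cov_diff_right cov_exp_filter diff_mem exp_filter_mem mem R)
  also have "\<dots> \<le> sqrt (cov R R) * D * drift_const a D"
    using holder_path.exp_filter_increment[OF holder_path_cov[OF R a] D N L, of t]
    by (simp add: drift_const_def)
  finally show "cov R R \<le> (D * drift_const a D)\<^sup>2"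
    by (intro square_le_of_self_bound) (simp_all add: mult.assoc)
qed

definition increment_cov_bound :: "real \<Rightarrow> nat \<Rightarrow> real" where
  "increment_cov_bound D n = (if h > 1/2 then (real n * D) powr (2 * h) else 2 * real n * D powr (2 * h))"

text \<open>Without absolute values the sum is the variance of \<open>X (n * D) - X 0\<close>. For
  \<open>h > 1/2\<close> all terms are nonnegative. Otherwise the off-diagonal ones are nonpositive,
  so the absolute sum is twice the diagonal minus that variance.\<close>

lemma sum_abs_cov_increments_le:
  assumes D: "0 < D"
  shows "(\<Sum>k<n. \<Sum>l<n. \<bar>cov (increment X D k) (increment X D l)\<bar>) \<le> increment_cov_bound D n"
proof -
  let ?c = "\<lambda>k l. cov (increment X D k) (increment X D l)"
  have c: "?c k l = 1 / 2 * (\<bar>(real k - real l) * D + D\<bar> powr (2 * h)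
      + \<bar>(real k - real l) * D - D\<bar> powr (2 * h) - 2 * \<bar>(real k - real l) * D\<bar> powr (2 * h))" for k l
  proof -
    have eqs: "real k * D + D - real l * D = (real k - real l) * D + D"
      "real k * D - (real l * D + D) = (real k - real l) * D - D"
      "real k * D + D - (real l * D + D) = (real k - real l) * D"
      "real k * D - real l * D = (real k - real l) * D"
      by (simp_all add: algebra_simps)
    show ?thesis unfolding increment_def cov_increments eqs by simp
  qed
  have self: "?c k k = D powr (2 * h)" for k
    using D by (simp add: c)
  have "(\<lambda>\<omega>. \<Sum>k<n. increment X D k \<omega>) = (\<lambda>\<omega>. X (real n * D) \<omega> - X (real 0 * D) \<omega>)"
  proof
    fix \<omega>
    have "(\<Sum>k<n. increment X D k \<omega>) = (\<Sum>k<n. X (real (Suc k) * D) \<omega> - X (real k * D) \<omega>)"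
      by (intro sum.cong) (simp_all add: increment_def algebra_simps)
    also have "\<dots> = X (real n * D) \<omega> - X (real 0 * D) \<omega>" by (rule sum_lessThan_telescope)
    finally show "(\<Sum>k<n. increment X D k \<omega>) = X (real n * D) \<omega> - X (real 0 * D) \<omega>" .
  qed
  then have "cov (\<lambda>\<omega>. \<Sum>k<n. increment X D k \<omega>) (\<lambda>\<omega>. \<Sum>k<n. increment X D k \<omega>) = (real n * D) powr (2 * h)"
    using D by (simp add: cov_increments)
  moreover have "cov (\<lambda>\<omega>. \<Sum>k<n. increment X D k \<omega>) (\<lambda>\<omega>. \<Sum>k<n. increment X D k \<omega>) = (\<Sum>k<n. \<Sum>l<n. ?c k l)"
    by (simp add: cov_sum_left cov_sum_right increment_mem sum_mem)
  ultimately have total: "(\<Sum>k<n. \<Sum>l<n. ?c k l) = (real n * D) powr (2 * h)" by simp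
  show ?thesis
  proof (cases "h > 1/2")
    case True
    have "0 \<le> ?c k l" for k l
      using second_difference_powr_nonneg[of "2 * h" "(real k - real l) * D" D] True by (simp add: c)
    then show ?thesis using total True by (simp add: increment_cov_bound_def)
  next
    case False
    have neg: "\<bar>?c k l\<bar> \<le> (if k = l then 2 * D powr (2 * h) else 0) - ?c k l" for k l
    proof (cases "k = l")
      case True
      then show ?thesis by (simp add: self)
    next
      case kl: False
      then have "1 \<le> \<bar>real k - real l\<bar>" by (cases "k < l") auto
      then have "\<bar>D\<bar> \<le> \<bar>(real k - real l) * D\<bar>" using D by (simp add: abs_mult)
      then have "?c k l \<le> 0"
        using second_difference_powr_nonpos[of "2 * h" D "(real k - real l) * D"] False hurst
        by (simp add: c)
      then show ?thesis using kl by simp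
    qed
    have "(\<Sum>k<n. \<Sum>l<n. \<bar>?c k l\<bar>) \<le> (\<Sum>k<n. \<Sum>l<n. (if k = l then 2 * D powr (2 * h) else 0) - ?c k l)"
      by (intro sum_mono neg)
    also have "\<dots> = 2 * real n * D powr (2 * h) - (real n * D) powr (2 * h)"
      unfolding sum_subtractf total by simp
    finally have "(\<Sum>k<n. \<Sum>l<n. \<bar>?c k l\<bar>) \<le> 2 * real n * D powr (2 * h)"
      using powr_ge_zero[of "real n * D" "2 * h"] by linarith
    then show ?thesis using False by (simp add: increment_cov_bound_def)
  qed
qed

end

section \<open>The mean square error for Riemann sums\<close>

text \<open>The roles are asymmetric: \<open>X1\<close> enters through its increments,
  \<open>X2\<close> through sums of neighbouring filter values. The number \<open>e\<close> is
  \<eta> for this order of the components.\<close>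

locale fbm_pair = X1: gaussian_fbm M G X1 h1 + X2: gaussian_fbm M G X2 h2
  for M :: "'w measure" and G X1 h1 X2 h2 +
  fixes \<rho> e a1 a2 p :: real
  assumes p: "p = h1 + h2" "p < 1"
    and rates: "0 < a1" "0 < a2"
    and cross: "X1.cov (X1 t) (X2 s) =
      1 / 2 * ((\<rho> + sign01 t * e) * \<bar>t\<bar> powr p + (\<rho> - sign01 s * e) * \<bar>s\<bar> powr p
               - cross_kernel \<rho> e p (s - t))"
begin

abbreviation cov where "cov \<equiv> X1.cov"

lemma p_pos: "0 < p"
  using X1.hurst X2.hurst p by simp

abbreviation "w \<equiv> cross_kernel \<rho> e p"

definition kernel_const :: real where
  "kernel_const = 2 * (\<bar>\<rho>\<bar> + \<bar>e\<bar>)"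

lemma kernel_const_nonneg: "0 \<le> kernel_const"
  by (simp add: kernel_const_def)

lemma holder_path_kernel: "holder_path w kernel_const p a2"
  using cross_kernel_holder[OF p_pos] p_pos p rates kernel_const_nonneg
  by unfold_locales (auto simp: kernel_const_def)

text \<open>Up to a constant in \<open>u\<close>, the covariance of the increment with
  \<open>X2 u\<close> is half the difference of two translates of the kernel \<open>w\<close>. The
  filter annihilates constants and commutes with translations, so the Langevin estimate for the path
  \<open>w\<close> applies.\<close>

lemma cov_increment_exp_filter:
  assumes D: "0 < D" and N: "0 < N" "\<epsilon> = D / real N" and L: "exp (- a2 * (real L * D)) \<le> D"
  shows "\<bar>cov (increment X1 D k) (\<lambda>\<omega>. exp_filter a2 \<epsilon> (L * N) (\<lambda>u. X2 u \<omega>) t)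
            - 1 / 2 * (w (t - real k * D) - w (t - real k * D - D))\<bar>
          \<le> 1 / 2 * (kernel_const * D * drift_const a2 D)"
proof -
  let ?s = "real k * D" and ?P = "exp_filter a2 \<epsilon> (L * N)"
  define c where "c = 1 / 2 * ((\<rho> + sign01 (?s + D) * e) * \<bar>?s + D\<bar> powr p
      - (\<rho> + sign01 ?s * e) * \<bar>?s\<bar> powr p)"
  have "cov (increment X1 D k) (X2 u) = 1 / 2 * (w (u - ?s) - w (u - (?s + D))) - (- c)" for u
    unfolding increment_def c_def
    by (simp add: X1.cov_diff_left X1.mem X2.mem cross field_simps)
  then have "cov (increment X1 D k) (\<lambda>\<omega>. ?P (\<lambda>u. X2 u \<omega>) t)
      = ?P (\<lambda>u. 1 / 2 * (w (u - ?s) - w (u - (?s + D))) - (- c)) t"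
    by (simp add: X1.cov_exp_filter X2.mem X1.increment_mem)
  also have "\<dots> = 1 / 2 * (?P w (t - ?s) - ?P w (t - (?s + D)))"
    unfolding exp_filter_diff exp_filter_const exp_filter_scale exp_filter_shift by simp
  finally have eq: "cov (increment X1 D k) (\<lambda>\<omega>. ?P (\<lambda>u. X2 u \<omega>) t)
      = 1 / 2 * (?P w (t - ?s) - ?P w (t - ?s - D))"
    by (simp add: algebra_simps)
  have "\<bar>?P w (t - ?s) - ?P w (t - ?s - D) - (w (t - ?s) - w (t - ?s - D))\<bar>
      \<le> kernel_const * D * drift_const a2 D"
    using holder_path.exp_filter_increment[OF holder_path_kernel D N L, of "t - ?s - D"]
    by (simp add: drift_const_def)
  then show ?thesis unfolding eq by (simp add: field_simps abs_le_iff)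
qed

text \<open>In order: boundary term, Langevin residual, first Isserlis pairing, second pairing (two
  summands), squared bias, all divided by \<open>(real n * D powr p)\<^sup>2\<close>. The outer 3
  comes from squaring a sum of three terms.\<close>

definition mse_bound :: "nat \<Rightarrow> real \<Rightarrow> real" where
  "mse_bound n D = 3 *
     (12 * ((1 + 1 / a1) * (1 + 1 / a2))\<^sup>2 / (real n * D powr p)\<^sup>2
      + 12 * ((1 + 1 / a2) * drift_const a1 D)\<^sup>2 * (D / D powr p)\<^sup>2
      + (4 * (1 + 1 / a2)\<^sup>2 * (X1.increment_cov_bound D n / (real n * D powr p)\<^sup>2)
         + 2 * kernel_const\<^sup>2 * (real n * D powr p * (real n * D) powr p / (real n * D powr p)\<^sup>2)
         + 2 * (kernel_const * drift_const a2 D)\<^sup>2 * (D / D powr p)\<^sup>2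
         + (kernel_const * drift_const a2 D)\<^sup>2 * (D / D powr p)\<^sup>2))"

section \<open>Estimates for fixed step, mesh and truncation\<close>

context
  fixes D \<epsilon> :: real and n L N :: nat
  assumes D: "0 < D" and n: "0 < n" and N: "0 < N" "\<epsilon> = D / real N"
    and L1: "exp (- a1 * (real L * D)) \<le> D" and L2: "exp (- a2 * (real L * D)) \<le> D"
begin

definition "F1 k = (\<lambda>\<omega>. exp_filter a1 \<epsilon> (L * N) (\<lambda>u. X1 u \<omega>) (real k * D))" for k :: nat
definition "F2 k = (\<lambda>\<omega>. exp_filter a2 \<epsilon> (L * N) (\<lambda>u. X2 u \<omega>) (real k * D))" for k :: nat

abbreviation "K1 \<equiv> 1 + 1 / a1"
abbreviation "K2 \<equiv> 1 + 1 / a2"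
abbreviation "A \<equiv> increment X1 D"

definition "S k = (\<lambda>\<omega>. F2 k \<omega> + F2 (Suc k) \<omega>)" for k
definition "R k = (\<lambda>\<omega>. F1 (Suc k) \<omega> - F1 k \<omega> - A k \<omega>)" for k

lemma eps: "0 < \<epsilon>"
  using D N by simp

lemma F_mem: "F1 k \<in> G" "F2 k \<in> G"
  unfolding F1_def F2_def by (intro X1.exp_filter_mem X1.mem X2.mem)+

lemma S_mem: "S k \<in> G"
  unfolding S_def by (intro X1.add_mem F_mem)

lemma R_mem: "R k \<in> G"
  unfolding R_def by (intro X1.diff_mem F_mem X1.increment_mem)

lemma F1_le: "cov (F1 k) (F1 k) \<le> K1\<^sup>2"
  unfolding F1_def by (intro X1.cov_exp_filter_le rates eps)

lemma F2_le: "cov (F2 k) (F2 k) \<le> K2\<^sup>2"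
  unfolding F2_def by (intro X2.cov_exp_filter_le rates eps)

lemma K_nonneg: "0 \<le> K1" "0 \<le> K2"
  using rates by auto

lemma S_cov: "\<bar>cov (S k) (S l)\<bar> \<le> 4 * K2\<^sup>2"
proof -
  have F: "\<bar>cov (F2 k) (F2 l)\<bar> \<le> K2 * K2" for k l
    using K_nonneg by (intro X1.cov_le F_mem F2_le)
  have "cov (S k) (S l) = cov (F2 k) (F2 l) + cov (F2 k) (F2 (Suc l))
      + (cov (F2 (Suc k)) (F2 l) + cov (F2 (Suc k)) (F2 (Suc l)))"
    unfolding S_def by (simp add: X1.cov_add_left X1.cov_add_right F_mem X1.add_mem)
  moreover have "\<bar>a + b + (c + d)\<bar> \<le> 4 * x"
    if "\<bar>a\<bar> \<le> x" "\<bar>b\<bar> \<le> x" "\<bar>c\<bar> \<le> x" "\<bar>d\<bar> \<le> x" for a b c d x :: real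
    using that by linarith
  ultimately show ?thesis by (simp only: power2_eq_square F)
qed

lemma R_le: "cov (R k) (R k) \<le> (D * drift_const a1 D)\<^sup>2"
proof -
  have "real k * D + D = real (Suc k) * D" by (simp add: algebra_simps)
  then show ?thesis
    using X1.cov_exp_filter_increment_le(2)[OF rates(1) D N L1, of "real k * D"]
    by (simp add: R_def F1_def increment_def)
qed

text \<open>The two filter values in \<open>S l\<close> contribute adjacent forward differences of
  \<open>w\<close>; their common value at \<open>(l - k) * D\<close> cancels and a centred
  difference remains.\<close>

lemma A_S_cov:
  "\<bar>cov (A k) (S l) - 1 / 2 * (w ((real l - real k) * D + D) - w ((real l - real k) * D - D))\<bar>
     \<le> kernel_const * D * drift_const a2 D"
proof -
  note c = cov_increment_exp_filter[OF D N L2, of k]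
  have "real l * D - real k * D = (real l - real k) * D"
    "real (Suc l) * D - real k * D = (real l - real k) * D + D"
    by (simp_all add: algebra_simps)
  then have "\<bar>cov (A k) (F2 l) - 1 / 2 * (w ((real l - real k) * D) - w ((real l - real k) * D - D))\<bar>
         \<le> 1 / 2 * (kernel_const * D * drift_const a2 D)"
    "\<bar>cov (A k) (F2 (Suc l)) - 1 / 2 * (w ((real l - real k) * D + D) - w ((real l - real k) * D))\<bar>
         \<le> 1 / 2 * (kernel_const * D * drift_const a2 D)"
    using c[of "real l * D"] c[of "real (Suc l) * D"] unfolding F2_def by (simp_all only: add_diff_cancel_right')
  moreover have "cov (A k) (S l) = cov (A k) (F2 l) + cov (A k) (F2 (Suc l))"
    unfolding S_def by (intro X1.cov_add_right F_mem X1.increment_mem)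
  moreover have "\<bar>b + c - 1 / 2 * (x - z)\<bar> \<le> d"
    if "\<bar>b - 1 / 2 * (y - z)\<bar> \<le> 1 / 2 * d" "\<bar>c - 1 / 2 * (x - y)\<bar> \<le> 1 / 2 * d"
    for b c d x y z :: real
    using that by (simp add: abs_le_iff field_simps)
  ultimately show ?thesis by (simp only:)
qed

text \<open>One factor of the squared difference is bounded by \<open>4 * D powr p\<close>, by
  Hoelder continuity. The other is kept, because it telescopes in \<open>l\<close>.\<close>

lemma A_S_cov_square:
  "(cov (A k) (S l))\<^sup>2 \<le> 1 / 2 * kernel_const\<^sup>2 * D powr p *
      (signed_powr p ((real l - real k) * D + D) - signed_powr p ((real l - real k) * D - D))
    + 2 * (kernel_const * D * drift_const a2 D)\<^sup>2"
proof -
  let ?x = "(real l - real k) * D"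
  let ?v = "signed_powr p (?x + D) - signed_powr p (?x - D)"
  let ?E = "kernel_const * D * drift_const a2 D"
  have v0: "0 \<le> ?v" using signed_powr_mono[of "?x - D" "?x + D" p] p_pos D by simp
  have "?v \<le> 2 * (2 * D) powr p"
    using signed_powr_holder[of p "?x + D" "?x - D"] p_pos p D by simp
  also have "\<dots> = 2 * (2 powr p * D powr p)" using D by (simp add: powr_mult)
  also have "\<dots> \<le> 2 * (2 * D powr p)"
    using powr_mono[of p 1 "2::real"] p by (intro mult_left_mono mult_right_mono) auto
  finally have v4: "?v \<le> 4 * D powr p" by simp
  have "\<bar>w (?x + D) - w (?x - D)\<bar> \<le> (\<bar>\<rho>\<bar> + \<bar>e\<bar>) * ?v"
    using cross_kernel_diff_le[OF p_pos, of \<rho> e "?x + D" "?x - D"] v0 by simp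
  then have "1 / 2 * \<bar>w (?x + D) - w (?x - D)\<bar> \<le> 1 / 2 * ((\<bar>\<rho>\<bar> + \<bar>e\<bar>) * ?v)"
    by (intro mult_left_mono) auto
  also have "\<dots> = 1 / 4 * kernel_const * ?v" by (simp add: kernel_const_def)
  finally have w: "\<bar>1 / 2 * (w (?x + D) - w (?x - D))\<bar> \<le> 1 / 4 * kernel_const * ?v"
    by (simp add: abs_mult)
  have E: "0 \<le> ?E" using kernel_const_nonneg D drift_const_nonneg[OF rates(2) D] by simp
  have "\<bar>cov (A k) (S l)\<bar> \<le> 1 / 4 * kernel_const * ?v + ?E"
    using A_S_cov[of k l] w by linarith
  then have "(cov (A k) (S l))\<^sup>2 \<le> (1 / 4 * kernel_const * ?v + ?E)\<^sup>2"
    by (metis abs_ge_zero power2_abs power_mono)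
  also have "\<dots> \<le> 2 * (1 / 4 * kernel_const * ?v)\<^sup>2 + 2 * ?E\<^sup>2"
    using sum_squares_bound[of "1 / 4 * kernel_const * ?v" ?E] by (simp add: power2_sum)
  also have "2 * (1 / 4 * kernel_const * ?v)\<^sup>2 = 1 / 8 * kernel_const\<^sup>2 * (?v * ?v)"
    by (simp add: power2_eq_square)
  also have "\<dots> \<le> 1 / 8 * kernel_const\<^sup>2 * (4 * D powr p * ?v)"
    using v0 v4 by (intro mult_left_mono mult_right_mono) auto
  also have "1 / 8 * kernel_const\<^sup>2 * (4 * D powr p * ?v) = 1 / 2 * kernel_const\<^sup>2 * D powr p * ?v"
    by simp
  finally show ?thesis by simp
qed

lemma sum_A_S_cov_square:
  "(\<Sum>k<n. \<Sum>l<n. (cov (A k) (S l))\<^sup>2) \<le>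
     2 * kernel_const\<^sup>2 * (real n * D powr p * (real n * D) powr p)
     + 2 * (real n * (kernel_const * D * drift_const a2 D))\<^sup>2"
proof -
  let ?E = "kernel_const * D * drift_const a2 D"
  let ?v = "\<lambda>k l. signed_powr p ((real l - real k) * D + D) - signed_powr p ((real l - real k) * D - D)"
  have "(\<Sum>l<n. (cov (A k) (S l))\<^sup>2) \<le>
      2 * kernel_const\<^sup>2 * (D powr p * (real n * D) powr p) + real n * (2 * ?E\<^sup>2)" if "k < n" for k
  proof -
    have "(\<Sum>l<n. (cov (A k) (S l))\<^sup>2) \<le> (\<Sum>l<n. 1 / 2 * kernel_const\<^sup>2 * D powr p * ?v k l + 2 * ?E\<^sup>2)"
      by (intro sum_mono A_S_cov_square)
    also have "\<dots> = 1 / 2 * kernel_const\<^sup>2 * D powr p * (\<Sum>l<n. ?v k l) + real n * (2 * ?E\<^sup>2)"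
      by (simp only: sum.distrib sum_distrib_left sum_constant card_lessThan)
    also have "\<dots> \<le> 1 / 2 * kernel_const\<^sup>2 * D powr p * (4 * (real n * D) powr p) + real n * (2 * ?E\<^sup>2)"
      by (intro add_right_mono mult_left_mono sum_signed_powr_telescope D p_pos that) auto
    finally show ?thesis by (simp add: mult_ac)
  qed
  then have "(\<Sum>k<n. \<Sum>l<n. (cov (A k) (S l))\<^sup>2) \<le>
      (\<Sum>k<n. 2 * kernel_const\<^sup>2 * (D powr p * (real n * D) powr p) + real n * (2 * ?E\<^sup>2))"
    by (intro sum_mono) auto
  also have "\<dots> = 2 * kernel_const\<^sup>2 * (real n * D powr p * (real n * D) powr p) + 2 * (real n * ?E)\<^sup>2"
    by (simp add: power2_eq_square algebra_simps)
  finally show ?thesis .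
qed

text \<open>The first pairing is controlled by \<open>S_cov\<close> and the absolute covariances of
  the increments. The second reduces to the sum of squares by the arithmetic-geometric mean
  inequality and symmetry in \<open>k\<close> and \<open>l\<close>. The last summand is the squared
  bias.\<close>

lemma variance_bound:
  "X1.expectation (\<lambda>\<omega>. ((\<Sum>k<n. A k \<omega> * S k \<omega>) + e * real n * D powr p)\<^sup>2)
     \<le> 4 * K2\<^sup>2 * X1.increment_cov_bound D n
       + 2 * kernel_const\<^sup>2 * (real n * D powr p * (real n * D) powr p)
       + 2 * (real n * (kernel_const * D * drift_const a2 D))\<^sup>2
       + (real n * (kernel_const * D * drift_const a2 D))\<^sup>2"
proof -
  let ?E = "kernel_const * D * drift_const a2 D"
  have "(\<Sum>k<n. \<Sum>l<n. cov (A k) (A l) * cov (S k) (S l)) \<le> (\<Sum>k<n. \<Sum>l<n. 4 * K2\<^sup>2 * \<bar>cov (A k) (A l)\<bar>)"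
  proof (intro sum_mono)
    fix k l
    have "cov (A k) (A l) * cov (S k) (S l) \<le> \<bar>cov (A k) (A l)\<bar> * \<bar>cov (S k) (S l)\<bar>"
      by (metis abs_ge_self abs_mult)
    also have "\<dots> \<le> \<bar>cov (A k) (A l)\<bar> * (4 * K2\<^sup>2)" by (intro mult_left_mono S_cov) simp
    finally show "cov (A k) (A l) * cov (S k) (S l) \<le> 4 * K2\<^sup>2 * \<bar>cov (A k) (A l)\<bar>" by (simp add: mult.commute)
  qed
  also have "\<dots> = 4 * K2\<^sup>2 * (\<Sum>k<n. \<Sum>l<n. \<bar>cov (A k) (A l)\<bar>)" by (simp only: sum_distrib_left)
  also have "\<dots> \<le> 4 * K2\<^sup>2 * X1.increment_cov_bound D n"
    by (intro mult_left_mono X1.sum_abs_cov_increments_le D) simp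
  finally have V1: "(\<Sum>k<n. \<Sum>l<n. cov (A k) (A l) * cov (S k) (S l)) \<le> 4 * K2\<^sup>2 * X1.increment_cov_bound D n" .
  have "(\<Sum>k<n. \<Sum>l<n. cov (A k) (S l) * cov (A l) (S k))
      \<le> (\<Sum>k<n. \<Sum>l<n. 1 / 2 * (cov (A k) (S l))\<^sup>2 + 1 / 2 * (cov (A l) (S k))\<^sup>2)"
  proof (intro sum_mono)
    fix k l
    show "cov (A k) (S l) * cov (A l) (S k) \<le> 1 / 2 * (cov (A k) (S l))\<^sup>2 + 1 / 2 * (cov (A l) (S k))\<^sup>2"
      using sum_squares_bound[of "cov (A k) (S l)" "cov (A l) (S k)"] by simp
  qed
  also have "\<dots> = 1 / 2 * (\<Sum>k<n. \<Sum>l<n. (cov (A k) (S l))\<^sup>2) + 1 / 2 * (\<Sum>k<n. \<Sum>l<n. (cov (A l) (S k))\<^sup>2)"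
    by (simp only: sum.distrib sum_distrib_left)
  also have "(\<Sum>k<n. \<Sum>l<n. (cov (A l) (S k))\<^sup>2) = (\<Sum>k<n. \<Sum>l<n. (cov (A k) (S l))\<^sup>2)"
    by (rule sum.swap)
  finally have V2: "(\<Sum>k<n. \<Sum>l<n. cov (A k) (S l) * cov (A l) (S k)) \<le> (\<Sum>k<n. \<Sum>l<n. (cov (A k) (S l))\<^sup>2)"
    by simp
  \<comment> \<open>At \<open>k = l\<close> the even part of the kernel drops out, so \<rho>
    disappears and each \<open>A k * S k\<close> has mean close to
    \<open>- e * D powr p\<close>.\<close>
  have w0: "w D - w (- D) = - 2 * e * D powr p"
    using D by (simp add: cross_kernel_def sign01_def algebra_simps)
  have "\<bar>(\<Sum>k<n. cov (A k) (S k)) + e * real n * D powr p\<bar> = \<bar>\<Sum>k<n. cov (A k) (S k) + e * D powr p\<bar>"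
    by (simp add: sum.distrib algebra_simps)
  also have "\<dots> \<le> (\<Sum>k<n. ?E)"
  proof (intro order_trans[OF sum_abs] sum_mono)
    fix k
    show "\<bar>cov (A k) (S k) + e * D powr p\<bar> \<le> ?E" using A_S_cov[of k k] w0 by simp
  qed
  also have "\<dots> = real n * ?E" by simp
  finally have V3: "((\<Sum>k<n. cov (A k) (S k)) + e * real n * D powr p)\<^sup>2 \<le> (real n * ?E)\<^sup>2"
    by (metis abs_ge_zero power2_abs power_mono)
  have "X1.expectation (\<lambda>\<omega>. ((\<Sum>k<n. A k \<omega> * S k \<omega>) + e * real n * D powr p)\<^sup>2) =
     (\<Sum>k<n. \<Sum>l<n. cov (A k) (A l) * cov (S k) (S l)) + (\<Sum>k<n. \<Sum>l<n. cov (A k) (S l) * cov (A l) (S k))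
     + ((\<Sum>k<n. cov (A k) (S k)) + e * real n * D powr p)\<^sup>2"
    by (subst X1.expectation_sum_products_square) (simp_all add: X1.increment_mem S_mem sum.distrib)
  then show ?thesis using V1 V2 V3 sum_A_S_cov_square by linarith
qed

text \<open>Cauchy-Schwarz over \<open>k\<close> loses nothing essential: the sum is of order
  \<open>n * D\<close> in mean square, and \<open>D / D powr p\<close> tends to 0 because
  \<open>p < 1\<close>.\<close>

lemma remainder_bound:
  "X1.expectation (\<lambda>\<omega>. (\<Sum>k<n. R k \<omega> * S k \<omega>)\<^sup>2) \<le> 12 * (real n * (D * drift_const a1 D * K2))\<^sup>2"
proof -
  have "(\<Sum>k<n. R k \<omega> * S k \<omega>)\<^sup>2 \<le> real n * (\<Sum>k<n. (R k \<omega> * S k \<omega>)\<^sup>2)" for \<omega>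
    using Cauchy_Schwarz_ineq_sum[of "\<lambda>_. 1" "\<lambda>k. R k \<omega> * S k \<omega>" "{..<n}"] by simp
  then have "X1.expectation (\<lambda>\<omega>. (\<Sum>k<n. R k \<omega> * S k \<omega>)\<^sup>2)
      \<le> X1.expectation (\<lambda>\<omega>. real n * (\<Sum>k<n. (R k \<omega> * S k \<omega>)\<^sup>2))"
    using X1.integrable_sum_products_square[of R S n 0]
    by (intro integral_mono) (auto simp: R_mem S_mem X1.integrable_square_mult)
  also have "\<dots> = real n * (\<Sum>k<n. X1.expectation (\<lambda>\<omega>. (R k \<omega> * S k \<omega>)\<^sup>2))"
    by (simp add: R_mem S_mem X1.integrable_square_mult)
  also have "\<dots> \<le> real n * (\<Sum>k<n. 3 * ((D * drift_const a1 D)\<^sup>2 * (4 * K2\<^sup>2)))"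
  proof (intro mult_left_mono sum_mono)
    fix k
    have "X1.expectation (\<lambda>\<omega>. (R k \<omega> * S k \<omega>)\<^sup>2) \<le> 3 * (cov (R k) (R k) * cov (S k) (S k))"
      by (intro X1.expectation_square_mult_le R_mem S_mem)
    also have "\<dots> \<le> 3 * ((D * drift_const a1 D)\<^sup>2 * (4 * K2\<^sup>2))"
      using S_cov[of k k] by (intro mult_left_mono mult_mono R_le) auto
    finally show "X1.expectation (\<lambda>\<omega>. (R k \<omega> * S k \<omega>)\<^sup>2) \<le> 3 * ((D * drift_const a1 D)\<^sup>2 * (4 * K2\<^sup>2))" .
  qed simp
  also have "\<dots> = 12 * (real n * (D * drift_const a1 D * K2))\<^sup>2"
    by (simp add: power2_eq_square)
  finally show ?thesis .
qed

lemma boundary_bound: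
  shows "integrable M (\<lambda>\<omega>. (F1 n \<omega> * F2 n \<omega> - F1 0 \<omega> * F2 0 \<omega>)\<^sup>2)"
    and "X1.expectation (\<lambda>\<omega>. (F1 n \<omega> * F2 n \<omega> - F1 0 \<omega> * F2 0 \<omega>)\<^sup>2) \<le> 12 * (K1 * K2)\<^sup>2"
proof -
  have eq: "(x * y - z * u)\<^sup>2 = x * y * x * y - 2 * (x * y * z * u) + z * u * z * u" for x y z u :: real
    by (simp add: power2_eq_square algebra_simps)
  show int: "integrable M (\<lambda>\<omega>. (F1 n \<omega> * F2 n \<omega> - F1 0 \<omega> * F2 0 \<omega>)\<^sup>2)"
    unfolding eq
    by (intro Bochner_Integration.integrable_add Bochner_Integration.integrable_diff
        integrable_mult_right X1.integrable_mult4 F_mem)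
  have le: "(x - y)\<^sup>2 \<le> 2 * x\<^sup>2 + 2 * y\<^sup>2" for x y :: real
    using sum_squares_bound[of x "- y"] by (simp add: power2_diff)
  have F: "X1.expectation (\<lambda>\<omega>. (F1 k \<omega> * F2 k \<omega>)\<^sup>2) \<le> 3 * (K1\<^sup>2 * K2\<^sup>2)" for k
    by (rule order_trans[OF X1.expectation_square_mult_le[OF F_mem(1) F_mem(2)]])
      (intro mult_left_mono mult_mono F1_le F2_le; simp)
  have "X1.expectation (\<lambda>\<omega>. (F1 n \<omega> * F2 n \<omega> - F1 0 \<omega> * F2 0 \<omega>)\<^sup>2)
     \<le> X1.expectation (\<lambda>\<omega>. 2 * (F1 n \<omega> * F2 n \<omega>)\<^sup>2 + 2 * (F1 0 \<omega> * F2 0 \<omega>)\<^sup>2)"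
    using int by (intro integral_mono le) (auto intro!: X1.integrable_square_mult F_mem)
  also have "\<dots> = 2 * X1.expectation (\<lambda>\<omega>. (F1 n \<omega> * F2 n \<omega>)\<^sup>2) + 2 * X1.expectation (\<lambda>\<omega>. (F1 0 \<omega> * F2 0 \<omega>)\<^sup>2)"
    by (simp add: X1.integrable_square_mult F_mem)
  also have "\<dots> \<le> 12 * (K1 * K2)\<^sup>2" using F[of n] F[of 0] by (simp add: power_mult_distrib)
  finally show "X1.expectation (\<lambda>\<omega>. (F1 n \<omega> * F2 n \<omega> - F1 0 \<omega> * F2 0 \<omega>)\<^sup>2) \<le> 12 * (K1 * K2)\<^sup>2" .
qed

text \<open>The bound depends on neither \<open>N\<close> nor \<open>L\<close>, and it is stated for
  the nonnegative integral, the form in which Fatou's lemma takes it.\<close>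

lemma filtered_statistic_mse:
  defines "Z \<equiv> (\<lambda>\<omega>. 1 / (real n * D powr p) *
      (\<Sum>k<n. F1 k \<omega> * F2 (Suc k) \<omega> - F1 (Suc k) \<omega> * F2 k \<omega>) - e)"
  shows "(\<integral>\<^sup>+\<omega>. ennreal ((Z \<omega>)\<^sup>2) \<partial>M) \<le> ennreal (mse_bound n D)"
proof -
  let ?c = "real n * D powr p"
  have c: "0 < ?c" using n D by simp
  let ?P = "\<lambda>\<omega>. F1 n \<omega> * F2 n \<omega> - F1 0 \<omega> * F2 0 \<omega>"
  let ?Q = "\<lambda>\<omega>. \<Sum>k<n. R k \<omega> * S k \<omega>"
  let ?T = "\<lambda>\<omega>. (\<Sum>k<n. A k \<omega> * S k \<omega>) + e * real n * D powr p"
  \<comment> \<open>Summation by parts: the statistic's summand is the increment of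
    \<open>F1 * F2\<close> minus \<open>(F1 (Suc k) - F1 k) * S k\<close>.\<close>
  have summand: "F1 k \<omega> * F2 (Suc k) \<omega> - F1 (Suc k) \<omega> * F2 k \<omega> =
      (F1 (Suc k) \<omega> * F2 (Suc k) \<omega> - F1 k \<omega> * F2 k \<omega>) - R k \<omega> * S k \<omega> - A k \<omega> * S k \<omega>" for k \<omega>
    by (simp add: R_def S_def algebra_simps)
  have Z: "Z \<omega> = 1 / ?c * (?P \<omega> - ?Q \<omega> - ?T \<omega>)" for \<omega>
  proof -
    have "(\<Sum>k<n. F1 k \<omega> * F2 (Suc k) \<omega> - F1 (Suc k) \<omega> * F2 k \<omega>) = ?P \<omega> - ?Q \<omega> - (\<Sum>k<n. A k \<omega> * S k \<omega>)"
      unfolding summand sum_subtractf sum_lessThan_telescope[of "\<lambda>k. F1 k \<omega> * F2 k \<omega>", unfolded sum_subtractf]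
      by simp
    moreover have "1 / ?c * x - e = 1 / ?c * (x - e * real n * D powr p)" for x
      using n D by (simp add: right_diff_distrib)
    ultimately show ?thesis unfolding Z_def by (simp add: diff_diff_eq)
  qed
  have three: "(x - y - z)\<^sup>2 \<le> 3 * (x\<^sup>2 + y\<^sup>2 + z\<^sup>2)" for x y z :: real
    using sum_squares_bound[of x "- y"] sum_squares_bound[of x "- z"] sum_squares_bound[of y z]
    by (simp add: power2_eq_square algebra_simps)
  have intP: "integrable M (\<lambda>\<omega>. (?P \<omega>)\<^sup>2)" by (rule boundary_bound)
  have intQ: "integrable M (\<lambda>\<omega>. (?Q \<omega>)\<^sup>2)"
    using X1.integrable_sum_products_square[of R S n 0] R_mem S_mem by simp
  have intT: "integrable M (\<lambda>\<omega>. (?T \<omega>)\<^sup>2)"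
    by (intro X1.integrable_sum_products_square X1.increment_mem S_mem)
  let ?U = "\<lambda>\<omega>. 3 / ?c\<^sup>2 * ((?P \<omega>)\<^sup>2 + (?Q \<omega>)\<^sup>2 + (?T \<omega>)\<^sup>2)"
  have ZU: "(Z \<omega>)\<^sup>2 \<le> ?U \<omega>" for \<omega>
  proof -
    have "(Z \<omega>)\<^sup>2 = 1 / ?c\<^sup>2 * (?P \<omega> - ?Q \<omega> - ?T \<omega>)\<^sup>2"
      unfolding Z by (simp add: power_mult_distrib power_divide)
    also have "\<dots> \<le> 1 / ?c\<^sup>2 * (3 * ((?P \<omega>)\<^sup>2 + (?Q \<omega>)\<^sup>2 + (?T \<omega>)\<^sup>2))"
      by (intro mult_left_mono three) simp
    finally show ?thesis by simp
  qed
  have "(\<integral>\<^sup>+\<omega>. ennreal ((Z \<omega>)\<^sup>2) \<partial>M) \<le> (\<integral>\<^sup>+\<omega>. ennreal (?U \<omega>) \<partial>M)"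
    by (intro nn_integral_mono ennreal_leI ZU)
  also have "\<dots> = ennreal (X1.expectation ?U)"
    by (intro nn_integral_eq_integral integrable_mult_right Bochner_Integration.integrable_add intP intQ intT AE_I2) simp
  also have "X1.expectation ?U = 3 / ?c\<^sup>2 * (X1.expectation (\<lambda>\<omega>. (?P \<omega>)\<^sup>2)
      + X1.expectation (\<lambda>\<omega>. (?Q \<omega>)\<^sup>2) + X1.expectation (\<lambda>\<omega>. (?T \<omega>)\<^sup>2))"
    using intP intQ intT by (simp only: integral_mult_right_zero Bochner_Integration.integral_add
        Bochner_Integration.integrable_add)
  also have "\<dots> \<le> 3 / ?c\<^sup>2 * (12 * (K1 * K2)\<^sup>2 + 12 * (real n * (D * drift_const a1 D * K2))\<^sup>2
     + (4 * K2\<^sup>2 * X1.increment_cov_bound D n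
       + 2 * kernel_const\<^sup>2 * (real n * D powr p * (real n * D) powr p)
       + 2 * (real n * (kernel_const * D * drift_const a2 D))\<^sup>2
       + (real n * (kernel_const * D * drift_const a2 D))\<^sup>2))"
    by (intro mult_left_mono add_mono boundary_bound(2) remainder_bound variance_bound[unfolded add.assoc[symmetric]])
      (auto)
  also have "\<dots> = mse_bound n D"
  proof -
    have sc: "3 / ?c\<^sup>2 * x = 3 * (x / ?c\<^sup>2)" for x by simp
    have r: "(real n * (D * y))\<^sup>2 / ?c\<^sup>2 = y\<^sup>2 * (D / D powr p)\<^sup>2" for y
      using n D by (simp add: power_mult_distrib power_divide)
    have "(real n * (D * drift_const a1 D * K2))\<^sup>2 / ?c\<^sup>2 = (K2 * drift_const a1 D)\<^sup>2 * (D / D powr p)\<^sup>2"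
      "(real n * (kernel_const * D * drift_const a2 D))\<^sup>2 / ?c\<^sup>2 = (kernel_const * drift_const a2 D)\<^sup>2 * (D / D powr p)\<^sup>2"
      using r[of "drift_const a1 D * K2"] r[of "kernel_const * drift_const a2 D"] by (simp_all only: ac_simps)
    then show ?thesis
      unfolding sc mse_bound_def
      by (simp only: add_divide_distrib times_divide_eq_right[symmetric] mult.assoc)
  qed
  finally show ?thesis by (simp add: ennreal_leI)
qed

end

end

section \<open>Asymptotics of the error bound\<close>

context fbm_pair
begin

lemma mse_bound_tendsto_0:
  assumes h: "1/2 < h1 \<or> h1 < 1/2 \<and> h2 < 1/2"
    and pos: "\<And>n. 0 < \<Delta> n" and \<Delta>: "\<Delta> \<longlonglongrightarrow> 0"
    and T: "filterlim (\<lambda>n. real n * \<Delta> n) at_top sequentially"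
  shows "(\<lambda>n. mse_bound n (\<Delta> n)) \<longlonglongrightarrow> 0"
proof -
  have pw: "(\<lambda>n. \<Delta> n powr s) \<longlonglongrightarrow> 0" if "0 < s" for s
    using tendsto_powr2[OF \<Delta> tendsto_const[of s] _ that] pos that
    by (simp add: less_imp_le)
  have inv: "(\<lambda>n. (real n * \<Delta> n) powr s) \<longlonglongrightarrow> 0" if "s < 0" for s
    using tendsto_neg_powr[OF that T] .
  let ?r = "\<lambda>n. \<Delta> n powr (1 - p)"
  have r: "?r \<longlonglongrightarrow> 0" using p by (intro pw) simp
  have r': "\<Delta> n / \<Delta> n powr p = ?r n" for n using pos[of n] by (simp add: powr_diff)
  have drift: "(\<lambda>n. drift_const a (\<Delta> n)) \<longlonglongrightarrow> drift_const a 0" for a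
    unfolding drift_const_def by (intro tendsto_intros \<Delta>)
  have t1: "(\<lambda>n. 1 / (real n * \<Delta> n powr p)\<^sup>2) \<longlonglongrightarrow> 0"
  proof -
    have "(\<lambda>n. ((real n * \<Delta> n) powr (- 1) * ?r n)\<^sup>2) \<longlonglongrightarrow> (0 * 0)\<^sup>2"
      by (intro tendsto_intros inv r) simp
    moreover have "\<forall>\<^sub>F n in sequentially. ((real n * \<Delta> n) powr (- 1) * ?r n)\<^sup>2 = 1 / (real n * \<Delta> n powr p)\<^sup>2"
      using eventually_gt_at_top[of 0]
    proof eventually_elim
      case (elim n)
      then have "(real n * \<Delta> n) powr (- 1) * ?r n = 1 / (real n * \<Delta> n powr p)"
        using pos[of n] by (simp add: powr_minus powr_diff field_simps)
      then show ?case by (simp add: power_divide)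
    qed
    ultimately show ?thesis using tendsto_cong by fastforce
  qed
  \<comment> \<open>All powers of \<open>\<Delta> n\<close> cancel, leaving
    \<open>n powr (p - 1)\<close>.\<close>
  have t2: "(\<lambda>n. real n * \<Delta> n powr p * (real n * \<Delta> n) powr p / (real n * \<Delta> n powr p)\<^sup>2) \<longlonglongrightarrow> 0"
  proof -
    have "(\<lambda>n. real n powr (p - 1)) \<longlonglongrightarrow> 0"
      using p by (intro tendsto_neg_powr filterlim_real_sequentially) simp
    moreover have "\<forall>\<^sub>F n in sequentially. real n powr (p - 1) =
        real n * \<Delta> n powr p * (real n * \<Delta> n) powr p / (real n * \<Delta> n powr p)\<^sup>2"
      using eventually_gt_at_top[of 0]
    proof eventually_elim
      case (elim n)
      then show ?case
        using pos[of n] by (simp add: powr_mult powr_diff power2_eq_square)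
    qed
    ultimately show ?thesis using tendsto_cong by fastforce
  qed
  \<comment> \<open>The choice of the first component enters here. For \<open>h1 < 1/2\<close> the
    quotient is \<open>2 / (n * \<Delta> n powr (2 * h2))\<close>, which is a negative power of
    \<open>n * \<Delta> n\<close> times a positive power of \<open>\<Delta> n\<close> exactly
    because \<open>h2 < 1/2\<close>.\<close>
  have t3: "(\<lambda>n. X1.increment_cov_bound (\<Delta> n) n / (real n * \<Delta> n powr p)\<^sup>2) \<longlonglongrightarrow> 0"
  proof (cases "1/2 < h1")
    case True
    have "(\<lambda>n. (real n * \<Delta> n) powr (2 * h1 - 2) * (?r n)\<^sup>2) \<longlonglongrightarrow> 0 * 0\<^sup>2"
      using X1.hurst by (intro tendsto_intros inv r) simp
    moreover have "\<forall>\<^sub>F n in sequentially. (real n * \<Delta> n) powr (2 * h1 - 2) * (?r n)\<^sup>2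
        = X1.increment_cov_bound (\<Delta> n) n / (real n * \<Delta> n powr p)\<^sup>2"
      using eventually_gt_at_top[of 0]
    proof eventually_elim
      case (elim n)
      let ?x = "real n * \<Delta> n"
      have x: "0 < ?x" using elim pos[of n] by simp
      have "?x powr (2 * h1 - 2) = ?x powr (2 * h1) / ?x\<^sup>2"
        using x by (simp add: powr_diff)
      then show ?case
        using elim pos[of n] True
        by (simp add: X1.increment_cov_bound_def powr_diff power_mult_distrib power_divide)
    qed
    ultimately show ?thesis using tendsto_cong by fastforce
  next
    case False
    then have h2: "h2 < 1/2" using h by simp
    have "(\<lambda>n. 2 * ((real n * \<Delta> n) powr (- 1) * \<Delta> n powr (1 - 2 * h2))) \<longlonglongrightarrow> 2 * (0 * 0)"
      using h2 by (intro tendsto_intros inv pw) simp_all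
    moreover have "\<forall>\<^sub>F n in sequentially. 2 * ((real n * \<Delta> n) powr (- 1) * \<Delta> n powr (1 - 2 * h2))
        = X1.increment_cov_bound (\<Delta> n) n / (real n * \<Delta> n powr p)\<^sup>2"
      using eventually_gt_at_top[of 0]
    proof eventually_elim
      case (elim n)
      have "(\<Delta> n powr p)\<^sup>2 = \<Delta> n powr (2 * h1) * \<Delta> n powr (2 * h2)"
        by (simp add: power2_eq_square p powr_add[symmetric])
      then show ?case
        using elim pos[of n] False
        by (simp add: X1.increment_cov_bound_def powr_minus powr_diff power_mult_distrib field_simps power2_eq_square)
    qed
    ultimately show ?thesis using tendsto_cong by fastforce
  qed
  have "(\<lambda>n. mse_bound n (\<Delta> n)) \<longlonglongrightarrow> 3 *
     (12 * ((1 + 1 / a1) * (1 + 1 / a2))\<^sup>2 * 0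
      + 12 * ((1 + 1 / a2) * drift_const a1 0)\<^sup>2 * 0\<^sup>2
      + (4 * (1 + 1 / a2)\<^sup>2 * 0
         + 2 * kernel_const\<^sup>2 * 0
         + 2 * (kernel_const * drift_const a2 0)\<^sup>2 * 0\<^sup>2
         + (kernel_const * drift_const a2 0)\<^sup>2 * 0\<^sup>2))"
    unfolding mse_bound_def r' divide_inverse[of "12 * _"] inverse_eq_divide
    by (intro tendsto_intros t1 t2 t3 r drift)
  then show ?thesis by simp
qed

end

section \<open>Passage to the Ornstein--Uhlenbeck process\<close>

text \<open>The tagged division whose Riemann-Stieltjes sum is the exponential filter.\<close>

lemma uniform_tagged_division:
  fixes t h :: real
  assumes h: "0 < h" and m: "0 < m"
  shows "(\<lambda>j. (t - real (Suc j) * h, {t - real (Suc j) * h..t - real j * h})) ` {..<m}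
           tagged_division_of {t - real m * h..t}"
proof (rule tagged_division_ofI)
  let ?I = "\<lambda>j. {t - real (Suc j) * h..t - real j * h}"
  show "finite ((\<lambda>j. (t - real (Suc j) * h, ?I j)) ` {..<m})" by simp
  fix x K assume "(x, K) \<in> (\<lambda>j. (t - real (Suc j) * h, ?I j)) ` {..<m}"
  then obtain j where j: "j < m" "x = t - real (Suc j) * h" "K = ?I j" by auto
  show "x \<in> K" using j h by (simp add: algebra_simps)
  show "\<exists>a b. K = cbox a b" using j by auto
  have "real (Suc j) * h \<le> real m * h" using j h by (intro mult_right_mono) auto
  then show "K \<subseteq> {t - real m * h..t}" using j h by (auto simp: algebra_simps)
next
  let ?I = "\<lambda>j. {t - real (Suc j) * h..t - real j * h}"
  fix x1 K1 x2 K2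
  assume "(x1, K1) \<in> (\<lambda>j. (t - real (Suc j) * h, ?I j)) ` {..<m}"
    and "(x2, K2) \<in> (\<lambda>j. (t - real (Suc j) * h, ?I j)) ` {..<m}" and ne: "(x1, K1) \<noteq> (x2, K2)"
  then obtain i j where ij: "K1 = ?I i" "K2 = ?I j" "i \<noteq> j" by auto
  have "interior (?I i) \<inter> interior (?I j) = {}" if "i < j" for i j :: nat
  proof -
    have "real (Suc i) * h \<le> real j * h" using that h by (intro mult_right_mono) auto
    then show ?thesis by auto
  qed
  then show "interior K1 \<inter> interior K2 = {}"
    using ij by (metis Int_commute nat_neq_iff)
next
  let ?I = "\<lambda>j. {t - real (Suc j) * h..t - real j * h}"
  have "(\<Union>j<m. ?I j) = {t - real m * h..t}" using m
  proof (induction m rule: nat_induct_non_zero)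
    case 1
    then show ?case by (simp add: lessThan_Suc)
  next
    case (Suc m)
    have "(\<Union>j<Suc m. ?I j) = {t - real (Suc m) * h..t - real m * h} \<union> {t - real m * h..t}"
      using Suc by (simp add: lessThan_Suc)
    also have "\<dots> = {t - real (Suc m) * h..t}"
      using h by (intro ivl_disj_un_two_touch) (auto simp: algebra_simps)
    finally show ?case .
  qed
  moreover have "{K. \<exists>x. (x, K) \<in> (\<lambda>j. (t - real (Suc j) * h, ?I j)) ` {..<m}} = ?I ` {..<m}"
    by (auto simp: image_iff simp del: of_nat_Suc)
  ultimately show "\<Union> {K. \<exists>x. (x, K) \<in> (\<lambda>j. (t - real (Suc j) * h, ?I j)) ` {..<m}} = {t - real m * h..t}"
    by (simp only:)
qed

text \<open>For every \<open>N\<close>, the \<open>L * Suc N\<close> cells of length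
  \<open>D / Suc N\<close> fill exactly the interval of length \<open>L * D\<close>, so only the
  mesh varies.\<close>

lemma exp_filter_tendsto_rs_integral:
  assumes rs: "has_rs_integral (\<lambda>u. exp (- a * (t - u))) g (t - real L * D) t I"
    and D: "0 < D" and L: "0 < L"
  shows "(\<lambda>N. exp_filter a (D / real (Suc N)) (L * Suc N) g t) \<longlonglongrightarrow> I"
proof (rule LIMSEQ_I)
  fix \<epsilon> :: real assume "0 < \<epsilon>"
  then obtain d where d: "0 < d" "\<And>q. q tagged_division_of {t - real L * D..t} \<Longrightarrow>
      (\<And>x K. (x, K) \<in> q \<Longrightarrow> Sup K - Inf K < d) \<Longrightarrow>
      \<bar>(\<Sum>(x, K)\<in>q. exp (- a * (t - x)) * (g (Sup K) - g (Inf K))) - I\<bar> < \<epsilon>"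
    using rs unfolding has_rs_integral_def by (metis (no_types, lifting) case_prodI2)
  have "(\<lambda>N. D * (1 / real (Suc N))) \<longlonglongrightarrow> D * 0"
    by (intro tendsto_intros LIMSEQ_Suc[OF lim_1_over_n])
  then have "\<forall>\<^sub>F N in sequentially. D * (1 / real (Suc N)) < d"
    using d(1) by (intro order_tendstoD) auto
  then obtain N0 where N0: "\<And>N. N0 \<le> N \<Longrightarrow> D / real (Suc N) < d"
    by (auto simp: eventually_sequentially)
  have "norm (exp_filter a (D / real (Suc N)) (L * Suc N) g t - I) < \<epsilon>" if "N0 \<le> N" for N
  proof -
    define h where "h = D / real (Suc N)"
    have h: "0 < h" "h < d" using D N0[OF that] by (simp_all add: h_def)
    have Lh: "real (L * Suc N) * h = real L * D" by (simp add: h_def field_simps)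
    let ?I = "\<lambda>j. {t - real (Suc j) * h..t - real j * h}"
    let ?q = "(\<lambda>j. (t - real (Suc j) * h, ?I j)) ` {..<L * Suc N}"
    have le: "t - real (Suc j) * h \<le> t - real j * h" for j using h by (simp add: algebra_simps)
    have q: "?q tagged_division_of {t - real L * D..t}"
      using uniform_tagged_division[OF h(1), of "L * Suc N" t] L unfolding Lh by simp
    have mesh: "Sup K - Inf K < d" if "(x, K) \<in> ?q" for x K
      using that le h by (auto simp: algebra_simps)
    have inj: "inj_on (\<lambda>j. (t - real (Suc j) * h, ?I j)) {..<L * Suc N}"
      using h by (auto simp: inj_on_def)
    have "(\<Sum>(x, K)\<in>?q. exp (- a * (t - x)) * (g (Sup K) - g (Inf K)))
        = (\<Sum>j<L * Suc N. exp (- a * (real (Suc j) * h)) * (g (t - real j * h) - g (t - real (Suc j) * h)))"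
      unfolding sum.reindex[OF inj] using le by (simp add: o_def)
    also have "\<dots> = exp_filter a h (L * Suc N) g t"
      unfolding exp_filter_def exp_of_nat_mult[symmetric] by (simp only: mult_ac)
    finally show ?thesis using d(2)[OF q mesh] by (simp add: h_def)
  qed
  then show "\<exists>no. \<forall>n\<ge>no. norm (exp_filter a (D / real (Suc n)) (L * Suc n) g t - I) < \<epsilon>" by blast
qed

text \<open>Fatou's lemma twice: first in the mesh index \<open>N\<close>, then in the truncation
  index \<open>L\<close>. The bound is asked for large \<open>L\<close> only, since the Langevin
  estimate needs \<open>exp (- a * (L * D)) \<le> D\<close>.\<close>

lemma nn_integral_iterated_limit_le:
  fixes Z :: "nat \<Rightarrow> nat \<Rightarrow> 'a \<Rightarrow> real"
  assumes [measurable]: "\<And>L N. Z L N \<in> borel_measurable M"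
    and lim: "AE \<omega> in M. \<exists>g. (\<forall>L. (\<lambda>N. Z L N \<omega>) \<longlonglongrightarrow> g L) \<and> g \<longlonglongrightarrow> X \<omega>"
    and bound: "\<forall>\<^sub>F L in sequentially. \<forall>N. (\<integral>\<^sup>+\<omega>. ennreal ((Z L N \<omega>)\<^sup>2) \<partial>M) \<le> c"
  shows "(\<integral>\<^sup>+\<omega>. ennreal ((X \<omega>)\<^sup>2) \<partial>M) \<le> c"
proof -
  have "AE \<omega> in M. ennreal ((X \<omega>)\<^sup>2) = liminf (\<lambda>L. liminf (\<lambda>N. ennreal ((Z L N \<omega>)\<^sup>2)))"
    using lim
  proof eventually_elim
    case (elim \<omega>)
    then obtain g where g: "\<And>L. (\<lambda>N. Z L N \<omega>) \<longlonglongrightarrow> g L" "g \<longlonglongrightarrow> X \<omega>" by blast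
    have "liminf (\<lambda>N. ennreal ((Z L N \<omega>)\<^sup>2)) = ennreal ((g L)\<^sup>2)" for L
      by (intro lim_imp_Liminf tendsto_ennrealI tendsto_power g) simp
    moreover have "liminf (\<lambda>L. ennreal ((g L)\<^sup>2)) = ennreal ((X \<omega>)\<^sup>2)"
      by (intro lim_imp_Liminf tendsto_ennrealI tendsto_power g) simp
    ultimately show ?case by simp
  qed
  then have "(\<integral>\<^sup>+\<omega>. ennreal ((X \<omega>)\<^sup>2) \<partial>M) = (\<integral>\<^sup>+\<omega>. liminf (\<lambda>L. liminf (\<lambda>N. ennreal ((Z L N \<omega>)\<^sup>2))) \<partial>M)"
    by (rule nn_integral_cong_AE)
  also have "\<dots> \<le> liminf (\<lambda>L. \<integral>\<^sup>+\<omega>. liminf (\<lambda>N. ennreal ((Z L N \<omega>)\<^sup>2)) \<partial>M)"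
    by (intro nn_integral_liminf) measurable
  also have "\<dots> \<le> liminf (\<lambda>L. liminf (\<lambda>N. \<integral>\<^sup>+\<omega>. ennreal ((Z L N \<omega>)\<^sup>2) \<partial>M))"
    by (intro Liminf_mono always_eventually allI nn_integral_liminf) measurable
  also have "\<dots> \<le> c"
  proof (intro Liminf_le)
    show "\<forall>\<^sub>F L in sequentially. liminf (\<lambda>N. \<integral>\<^sup>+\<omega>. ennreal ((Z L N \<omega>)\<^sup>2) \<partial>M) \<le> c"
      using bound by eventually_elim (auto intro!: Liminf_le)
  qed simp
  finally show ?thesis .
qed

lemma exp_filter_tendsto_fractional_ou:
  assumes ou: "has_rs_integral_at_bot (\<lambda>u. exp (- a * (t - u))) g t I" and D: "0 < D"
  shows "\<exists>F. (\<forall>L. (\<lambda>N. exp_filter a (D / real (Suc N)) (Suc L * Suc N) g t) \<longlonglongrightarrow> F L) \<and> F \<longlonglongrightarrow> I"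
proof -
  obtain F where F: "\<And>s. s \<le> t \<Longrightarrow> has_rs_integral (\<lambda>u. exp (- a * (t - u))) g s t (F s)"
    and lim: "(F \<longlongrightarrow> I) at_bot"
    using ou unfolding has_rs_integral_at_bot_def by blast
  have "filterlim (\<lambda>L. real (Suc L)) at_top sequentially"
    using filterlim_real_sequentially by (rule filterlim_compose[OF _ filterlim_Suc])
  then have top: "filterlim (\<lambda>L. D * real (Suc L)) at_top sequentially"
    by (intro filterlim_tendsto_pos_mult_at_top[OF tendsto_const D])
  have "filterlim (\<lambda>L. t - D * real (Suc L)) at_bot sequentially"
    unfolding filterlim_at_bot
  proof
    fix z
    have "\<forall>\<^sub>F L in sequentially. t - z \<le> D * real (Suc L)"
      using top by (simp only: filterlim_at_top)
    then show "\<forall>\<^sub>F L in sequentially. t - D * real (Suc L) \<le> z"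
      by eventually_elim linarith
  qed
  then have "(\<lambda>L. F (t - real (Suc L) * D)) \<longlonglongrightarrow> I"
    using filterlim_compose[OF lim] by (simp add: mult.commute)
  moreover have "(\<lambda>N. exp_filter a (D / real (Suc N)) (Suc L * Suc N) g t) \<longlonglongrightarrow> F (t - real (Suc L) * D)" for L
    using D by (intro exp_filter_tendsto_rs_integral F) (simp_all del: of_nat_Suc)
  ultimately show ?thesis
    by (intro exI[of _ "\<lambda>L. F (t - real (Suc L) * D)"] conjI allI)
qed

context fbm_pair
begin

text \<open>Along almost every path the filters converge to \<open>Y1 / v1\<close> and
  \<open>Y2 / v2\<close>, mesh first and truncation second; the factors \<open>v1\<close> and
  \<open>v2\<close> cancel against the normalisation.\<close>

lemma ou_statistic_mse:
  assumes Y: "fractional_ou M a1 v1 X1 Y1" "fractional_ou M a2 v2 X2 Y2"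
    and v: "0 < v1" "0 < v2" and D: "0 < D" and n: "0 < n"
  shows "(\<integral>\<^sup>+\<omega>. ennreal ((1 / (v1 * v2 * real n * D powr p) *
      (\<Sum>k<n. Y1 (real k * D) \<omega> * Y2 (real (Suc k) * D) \<omega> - Y1 (real (Suc k) * D) \<omega> * Y2 (real k * D) \<omega>) - e)\<^sup>2) \<partial>M)
    \<le> ennreal (mse_bound n D)"
proof -
  define \<Phi>1 where "\<Phi>1 L N k \<omega> = exp_filter a1 (D / real (Suc N)) (Suc L * Suc N) (\<lambda>u. X1 u \<omega>) (real k * D)"
    for L N k \<omega>
  define \<Phi>2 where "\<Phi>2 L N k \<omega> = exp_filter a2 (D / real (Suc N)) (Suc L * Suc N) (\<lambda>u. X2 u \<omega>) (real k * D)"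
    for L N k \<omega>
  define Z where "Z L N \<omega> = 1 / (real n * D powr p) *
      (\<Sum>k<n. \<Phi>1 L N k \<omega> * \<Phi>2 L N (Suc k) \<omega> - \<Phi>1 L N (Suc k) \<omega> * \<Phi>2 L N k \<omega>) - e" for L N \<omega>
  have small: "\<forall>\<^sub>F L in sequentially. exp (- a * (real (Suc L) * D)) \<le> D" if a: "0 < a" for a
  proof -
    have "(\<lambda>L. exp (- a * D) ^ Suc L) \<longlonglongrightarrow> 0"
      using a D by (intro LIMSEQ_Suc LIMSEQ_power_zero) simp
    then have "\<forall>\<^sub>F L in sequentially. exp (- a * D) ^ Suc L < D"
      using D by (rule order_tendstoD)
    then show ?thesis
      by eventually_elim (simp only: exp_of_nat_mult[symmetric] mult_ac less_imp_le)
  qed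
  have [measurable]: "\<Phi>1 L N k \<in> borel_measurable M" "\<Phi>2 L N k \<in> borel_measurable M" for L N k
    unfolding \<Phi>1_def[abs_def] \<Phi>2_def[abs_def]
    by (intro X1.measurable_mem X1.exp_filter_mem X1.mem X2.mem)+
  show ?thesis
  proof (rule nn_integral_iterated_limit_le[where Z = Z])
    show "Z L N \<in> borel_measurable M" for L N
      unfolding Z_def by measurable
    show "\<forall>\<^sub>F L in sequentially. \<forall>N. (\<integral>\<^sup>+\<omega>. ennreal ((Z L N \<omega>)\<^sup>2) \<partial>M) \<le> ennreal (mse_bound n D)"
      using small[OF rates(1)] small[OF rates(2)]
    proof eventually_elim
      case (elim L)
      show ?case
      proof
        fix N
        show "(\<integral>\<^sup>+\<omega>. ennreal ((Z L N \<omega>)\<^sup>2) \<partial>M) \<le> ennreal (mse_bound n D)"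
          using filtered_statistic_mse[where N = "Suc N" and \<epsilon> = "D / real (Suc N)" and L = "Suc L",
              OF D n zero_less_Suc refl elim]
          unfolding Z_def \<Phi>1_def \<Phi>2_def
            F1_def[where N = "Suc N" and \<epsilon> = "D / real (Suc N)" and L = "Suc L", OF D n zero_less_Suc refl elim]
            F2_def[where N = "Suc N" and \<epsilon> = "D / real (Suc N)" and L = "Suc L", OF D n zero_less_Suc refl elim] .
      qed
    qed
    from Y have "AE \<omega> in M. \<forall>t. \<exists>I. has_rs_integral_at_bot (\<lambda>u. exp (- a1 * (t - u))) (\<lambda>u. X1 u \<omega>) t I \<and> Y1 t \<omega> = v1 * I"
      "AE \<omega> in M. \<forall>t. \<exists>I. has_rs_integral_at_bot (\<lambda>u. exp (- a2 * (t - u))) (\<lambda>u. X2 u \<omega>) t I \<and> Y2 t \<omega> = v2 * I"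
      by (auto simp: fractional_ou_def)
    then show "AE \<omega> in M. \<exists>g. (\<forall>L. (\<lambda>N. Z L N \<omega>) \<longlonglongrightarrow> g L) \<and>
        g \<longlonglongrightarrow> 1 / (v1 * v2 * real n * D powr p) *
      (\<Sum>k<n. Y1 (real k * D) \<omega> * Y2 (real (Suc k) * D) \<omega> - Y1 (real (Suc k) * D) \<omega> * Y2 (real k * D) \<omega>) - e"
    proof eventually_elim
      case (elim \<omega>)
      \<comment> \<open>The almost sure statement covers all times, so limits exist for every
        \<open>k\<close> on one event.\<close>
      have "\<exists>I F. (\<forall>L. (\<lambda>N. \<Phi>1 L N k \<omega>) \<longlonglongrightarrow> F L) \<and> F \<longlonglongrightarrow> I \<and> Y1 (real k * D) \<omega> = v1 * I" for k
      proof -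
        obtain I where I: "has_rs_integral_at_bot (\<lambda>u. exp (- a1 * (real k * D - u))) (\<lambda>u. X1 u \<omega>) (real k * D) I"
          "Y1 (real k * D) \<omega> = v1 * I" using elim(1) by blast
        then show ?thesis
          using exp_filter_tendsto_fractional_ou[OF I(1) D] unfolding \<Phi>1_def by blast
      qed
      then obtain I1 F1 where 1: "\<And>k L. (\<lambda>N. \<Phi>1 L N k \<omega>) \<longlonglongrightarrow> F1 k L" "\<And>k. F1 k \<longlonglongrightarrow> I1 k"
        "\<And>k. Y1 (real k * D) \<omega> = v1 * I1 k" by metis
      have "\<exists>I F. (\<forall>L. (\<lambda>N. \<Phi>2 L N k \<omega>) \<longlonglongrightarrow> F L) \<and> F \<longlonglongrightarrow> I \<and> Y2 (real k * D) \<omega> = v2 * I" for k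
      proof -
        obtain I where I: "has_rs_integral_at_bot (\<lambda>u. exp (- a2 * (real k * D - u))) (\<lambda>u. X2 u \<omega>) (real k * D) I"
          "Y2 (real k * D) \<omega> = v2 * I" using elim(2) by blast
        then show ?thesis
          using exp_filter_tendsto_fractional_ou[OF I(1) D] unfolding \<Phi>2_def by blast
      qed
      then obtain I2 F2 where 2: "\<And>k L. (\<lambda>N. \<Phi>2 L N k \<omega>) \<longlonglongrightarrow> F2 k L" "\<And>k. F2 k \<longlonglongrightarrow> I2 k"
        "\<And>k. Y2 (real k * D) \<omega> = v2 * I2 k" by metis
      let ?g = "\<lambda>L. 1 / (real n * D powr p) * (\<Sum>k<n. F1 k L * F2 (Suc k) L - F1 (Suc k) L * F2 k L) - e"
      have g1: "(\<lambda>N. Z L N \<omega>) \<longlonglongrightarrow> ?g L" for L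
        unfolding Z_def by (intro tendsto_intros 1 2)
      have g2: "?g \<longlonglongrightarrow> 1 / (real n * D powr p) * (\<Sum>k<n. I1 k * I2 (Suc k) - I1 (Suc k) * I2 k) - e"
        by (intro tendsto_intros 1 2)
      have scale: "1 / (v1 * v2 * real n * D powr p) *
          (\<Sum>k<n. v1 * I1 k * (v2 * I2 (Suc k)) - v1 * I1 (Suc k) * (v2 * I2 k))
          = 1 / (real n * D powr p) * (\<Sum>k<n. I1 k * I2 (Suc k) - I1 (Suc k) * I2 k)"
      proof -
        have "(\<Sum>k<n. v1 * I1 k * (v2 * I2 (Suc k)) - v1 * I1 (Suc k) * (v2 * I2 k))
            = v1 * v2 * (\<Sum>k<n. I1 k * I2 (Suc k) - I1 (Suc k) * I2 k)"
          by (simp add: sum_distrib_left algebra_simps)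
        then show ?thesis using v by (simp add: field_simps)
      qed
      show ?case unfolding 1(3) 2(3) scale
        by (intro exI[of _ ?g] conjI allI g1 g2)
    qed
  qed
qed

end

section \<open>Consistency of the estimator\<close>

lemma (in prob_space) converges_in_L2I:
  assumes X [measurable]: "\<And>n. X n \<in> borel_measurable M"
    and bound: "\<And>n. (\<integral>\<^sup>+\<omega>. ennreal ((X n \<omega> - c)\<^sup>2) \<partial>M) \<le> ennreal (b n)"
    and b: "b \<longlonglongrightarrow> 0"
  shows "converges_in_L2 M X (\<lambda>_. c)"
proof -
  have int: "integrable M (\<lambda>\<omega>. (X n \<omega> - c)\<^sup>2)" for n
    using bound[of n] by (intro integrableI_nonneg) (auto simp: less_top[symmetric] top_unique)
  have "integrable M (\<lambda>\<omega>. (X n \<omega>)\<^sup>2)" for n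
  proof (rule Bochner_Integration.integrable_bound)
    show "integrable M (\<lambda>\<omega>. 2 * (X n \<omega> - c)\<^sup>2 + 2 * c\<^sup>2)"
      using int by simp
    have "x\<^sup>2 \<le> 2 * (x - c)\<^sup>2 + 2 * c\<^sup>2" for x :: real
      using sum_squares_bound[of "x - c" c] zero_le_power2[of "x - 2 * c"]
      by (simp add: power2_eq_square algebra_simps)
    then show "AE \<omega> in M. norm ((X n \<omega>)\<^sup>2) \<le> norm (2 * (X n \<omega> - c)\<^sup>2 + 2 * c\<^sup>2)"
      by (intro AE_I2) simp
  qed measurable
  moreover have "(\<lambda>n. expectation (\<lambda>\<omega>. (X n \<omega> - c)\<^sup>2)) \<longlonglongrightarrow> 0"
  proof (rule tendsto_sandwich[OF _ _ tendsto_const])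
    \<comment> \<open>\<open>ennreal\<close> truncates negative values to 0, so the real-valued
      comparison is with \<open>\<bar>b n\<bar>\<close>.\<close>
    show "(\<lambda>n. \<bar>b n\<bar>) \<longlonglongrightarrow> 0" using b by (rule tendsto_rabs_zero)
    have "ennreal (expectation (\<lambda>\<omega>. (X n \<omega> - c)\<^sup>2)) \<le> ennreal \<bar>b n\<bar>" for n
      using bound[of n] int[of n] by (subst nn_integral_eq_integral[symmetric])
        (auto intro: order_trans ennreal_leI)
    then show "\<forall>\<^sub>F n in sequentially. expectation (\<lambda>\<omega>. (X n \<omega> - c)\<^sup>2) \<le> \<bar>b n\<bar>" by simp
  qed simp
  ultimately show ?thesis by (simp add: converges_in_L2_def)
qed

text \<open>Chebyshev's inequality.\<close>

lemma (in prob_space) converges_in_L2_imp_in_probability: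
  assumes conv: "converges_in_L2 M X (\<lambda>_. c)"
  shows "converges_in_probability M X (\<lambda>_. c)"
  unfolding converges_in_probability_def
proof (intro conjI allI impI)
  have [measurable]: "X n \<in> borel_measurable M" for n
    using conv by (simp add: converges_in_L2_def)
  show "X n \<in> borel_measurable M" for n by measurable
  fix \<epsilon> :: real assume \<epsilon>: "0 < \<epsilon>"
  have lim: "(\<lambda>n. expectation (\<lambda>\<omega>. (X n \<omega> - c)\<^sup>2)) \<longlonglongrightarrow> 0"
    using conv by (simp add: converges_in_L2_def)
  have le: "prob {\<omega> \<in> space M. \<bar>X n \<omega> - c\<bar> > \<epsilon>} \<le> expectation (\<lambda>\<omega>. (X n \<omega> - c)\<^sup>2) / \<epsilon>\<^sup>2" for n
  proof -
    have int: "integrable M (\<lambda>\<omega>. (X n \<omega> - c)\<^sup>2)"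
    proof (rule Bochner_Integration.integrable_bound)
      show "integrable M (\<lambda>\<omega>. 2 * (X n \<omega>)\<^sup>2 + 2 * c\<^sup>2)"
        using conv by (auto simp: converges_in_L2_def)
      have "(x - c)\<^sup>2 \<le> 2 * x\<^sup>2 + 2 * c\<^sup>2" for x :: real
        using sum_squares_bound[of x "- c"] by (simp add: power2_diff)
      then show "AE \<omega> in M. norm ((X n \<omega> - c)\<^sup>2) \<le> norm (2 * (X n \<omega>)\<^sup>2 + 2 * c\<^sup>2)"
        by (intro AE_I2) simp
    qed measurable
    have "prob {\<omega> \<in> space M. \<bar>X n \<omega> - c\<bar> > \<epsilon>} \<le> prob {\<omega> \<in> space M. (X n \<omega> - c)\<^sup>2 \<ge> \<epsilon>\<^sup>2}"
    proof (intro finite_measure_mono)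
      show "{\<omega> \<in> space M. \<bar>X n \<omega> - c\<bar> > \<epsilon>} \<subseteq> {\<omega> \<in> space M. (X n \<omega> - c)\<^sup>2 \<ge> \<epsilon>\<^sup>2}"
        using \<epsilon> by (auto simp: abs_le_square_iff[symmetric])
    qed measurable
    also have "\<dots> \<le> expectation (\<lambda>\<omega>. (X n \<omega> - c)\<^sup>2) / \<epsilon>\<^sup>2"
      using \<epsilon> by (intro integral_Markov_inequality_measure[where A = "space M"] int) auto
    finally show ?thesis .
  qed
  show "(\<lambda>n. prob {\<omega> \<in> space M. \<bar>X n \<omega> - c\<bar> > \<epsilon>}) \<longlonglongrightarrow> 0"
    by (rule tendsto_sandwich[OF _ _ tendsto_const tendsto_divide_zero[OF lim, of "\<epsilon>\<^sup>2"]])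
      (use le in auto)
qed simp

text \<open>\<open>G\<close> is spanned by both components together, so Isserlis' formula applies to
  products mixing them. Both orders of the components are allowed.\<close>

lemma fbm_pair_of_bivariate_fbm:
  assumes M: "prob_space M" and B: "bivariate_fbm M H \<rho> \<eta> B" and H: "H 1 + H 2 < 1"
    and ij: "(i, j) \<in> {(1, 2), (2, 1)}" and \<alpha>: "0 < \<alpha> i" "0 < \<alpha> j"
  obtains G where "fbm_pair M G (B i) (H i) (B j) (H j) \<rho> (\<eta> i j) (\<alpha> i) (\<alpha> j) (H 1 + H 2)"
proof -
  define X where "X = (\<lambda>(i, t). B i t)"
  define G where "G = {Z. \<exists>J c. finite J \<and> J \<subseteq> {1, 2} \<times> UNIV \<and> Z = (\<lambda>\<omega>. \<Sum>i\<in>J. c i * X i \<omega>)}"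
  have "centered_gaussian_process M ({1, 2} \<times> UNIV) X"
    using B by (simp add: bivariate_fbm_def X_def)
  from centered_gaussian_space_lincombs[OF M this]
  interpret centered_gaussian_space M G unfolding G_def .
  have mem: "B l t \<in> G" if "l \<in> {1, 2}" for l t
  proof -
    have "B l t = (\<lambda>\<omega>. \<Sum>i\<in>{(l, t)}. 1 * X i \<omega>)" by (simp add: X_def)
    moreover have "finite {(l, t)} \<and> {(l, t)} \<subseteq> {1, 2} \<times> UNIV" using that by simp
    ultimately show ?thesis unfolding G_def
      by (intro CollectI exI[of _ "{(l, t)}"] exI[of _ "\<lambda>_. 1"]) simp
  qed
  have fbm: "gaussian_fbm M G (B l) (H l)" if l: "l \<in> {1, 2}" for l
  proof -
    from B l have 1: "fractional_brownian_motion M (H l) (B l)" "expectation (\<lambda>\<omega>. (B l 1 \<omega>)\<^sup>2) = 1"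
      unfolding bivariate_fbm_def by blast+
    then have "cov (B l t) (B l s) =
        1 / 2 * (\<bar>t\<bar> powr (2 * H l) + \<bar>s\<bar> powr (2 * H l) - \<bar>t - s\<bar> powr (2 * H l))" for t s
      unfolding fractional_brownian_motion_def cov_def by simp
    then show ?thesis
      using 1 mem[OF l] by unfold_locales (auto simp: fractional_brownian_motion_def)
  qed
  have ij': "i \<in> {1, 2}" "j \<in> {1, 2}" "i \<noteq> j" "H i + H j = H 1 + H 2" using ij by auto
  interpret X1: gaussian_fbm M G "B i" "H i" by (rule fbm[OF ij'(1)])
  interpret X2: gaussian_fbm M G "B j" "H j" by (rule fbm[OF ij'(2)])
  have "cov (B i t) (B j s) =
      1 / 2 * ((\<rho> + sign01 t * \<eta> i j) * \<bar>t\<bar> powr (H 1 + H 2) + (\<rho> - sign01 s * \<eta> i j) * \<bar>s\<bar> powr (H 1 + H 2)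
               - cross_kernel \<rho> (\<eta> i j) (H 1 + H 2) (s - t))" for t s
    using B ij' unfolding bivariate_fbm_def cov_def cross_kernel_def by blast
  then have "fbm_pair M G (B i) (H i) (B j) (H j) \<rho> (\<eta> i j) (\<alpha> i) (\<alpha> j) (H 1 + H 2)"
    using H \<alpha> ij'(4) by unfold_locales auto
  then show ?thesis by (rule that)
qed

text \<open>Interchanging the components changes the sign of the statistic and of \<eta>, hence
  leaves the squared error unchanged.\<close>

lemma eta_tilde_mse:
  assumes M: "prob_space M" and B: "bivariate_fbm M H \<rho> \<eta> B" and Y: "bivariate_fou M \<alpha> \<nu> B Y"
    and H: "H 1 + H 2 < 1" and ij: "(i, j) \<in> {(1, 2), (2, 1)}"
    and Hij: "1/2 < H i \<or> H i < 1/2 \<and> H j < 1/2"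
    and \<Delta>: "\<And>n. 0 < \<Delta> n" "\<Delta> \<longlonglongrightarrow> 0" "filterlim (\<lambda>n. real n * \<Delta> n) at_top sequentially"
  obtains b where "b \<longlonglongrightarrow> 0"
    and "\<And>n. 0 < n \<Longrightarrow> (\<integral>\<^sup>+\<omega>. ennreal ((eta_tilde H \<nu> \<Delta> Y n \<omega> - \<eta> 1 2)\<^sup>2) \<partial>M) \<le> ennreal (b n)"
proof -
  have ij': "i \<in> {1, 2}" "j \<in> {1, 2}" using ij by auto
  have pos: "0 < \<alpha> i" "0 < \<alpha> j" "0 < \<nu> i" "0 < \<nu> j"
    and ou: "fractional_ou M (\<alpha> i) (\<nu> i) (B i) (Y i)" "fractional_ou M (\<alpha> j) (\<nu> j) (B j) (Y j)"
    using Y ij' by (auto simp: bivariate_fou_def)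
  obtain G where "fbm_pair M G (B i) (H i) (B j) (H j) \<rho> (\<eta> i j) (\<alpha> i) (\<alpha> j) (H 1 + H 2)"
    by (rule fbm_pair_of_bivariate_fbm[where \<alpha> = \<alpha>, OF M B H ij pos(1,2)])
  then interpret fbm_pair M G "B i" "H i" "B j" "H j" \<rho> "\<eta> i j" "\<alpha> i" "\<alpha> j" "H 1 + H 2" .
  let ?s = "\<lambda>n \<omega>. 1 / (\<nu> i * \<nu> j * real n * \<Delta> n powr (H 1 + H 2)) *
      (\<Sum>k<n. Y i (real k * \<Delta> n) \<omega> * Y j (real (Suc k) * \<Delta> n) \<omega>
             - Y i (real (Suc k) * \<Delta> n) \<omega> * Y j (real k * \<Delta> n) \<omega>)"
  have "(eta_tilde H \<nu> \<Delta> Y n \<omega> - \<eta> 1 2)\<^sup>2 = (?s n \<omega> - \<eta> i j)\<^sup>2" for n \<omega>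
  proof (cases "i = 1")
    case True
    then have "j = 2" using ij by auto
    then show ?thesis using True by (simp only: eta_tilde_def Suc_eq_plus1)
  next
    case False
    then have i: "i = 2" "j = 1" using ij by auto
    have "?s n \<omega> = - eta_tilde H \<nu> \<Delta> Y n \<omega>"
      unfolding i eta_tilde_def Suc_eq_plus1 mult_minus_right[symmetric] sum_negf[symmetric] minus_diff_eq
      by (simp only: mult.commute)
    moreover have "\<eta> i j = - \<eta> 1 2" using B i by (simp add: bivariate_fbm_def)
    ultimately show ?thesis by (simp add: power2_eq_square algebra_simps)
  qed
  then show ?thesis
    using that[OF mse_bound_tendsto_0[OF Hij \<Delta>]] ou_statistic_mse[OF ou pos(3,4) \<Delta>(1)] by simp
qed

theorem theorem6p2p15:
  fixes M :: "'w measure"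
    and H \<alpha> \<nu> :: "nat \<Rightarrow> real"
    and \<rho> :: real
    and \<eta> :: "nat \<Rightarrow> nat \<Rightarrow> real"
    and B Y :: "nat \<Rightarrow> real \<Rightarrow> 'w \<Rightarrow> real"
    and \<Delta> :: "nat \<Rightarrow> real"
  assumes "prob_space M"
    and "H 1 \<in> {0<..<1} - {1/2}" and "H 2 \<in> {0<..<1} - {1/2}"
    and "H 1 + H 2 < 1"
    and "bivariate_fbm M H \<rho> \<eta> B"
    and "bivariate_fou M \<alpha> \<nu> B Y"
    and "\<And>n. \<Delta> n > 0"
    and "\<Delta> \<longlonglongrightarrow> 0"
    and "filterlim (\<lambda>n. real n * \<Delta> n) at_top sequentially"
  shows "converges_in_L2 M (eta_tilde H \<nu> \<Delta> Y) (\<lambda>_. \<eta> 1 2)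
       \<and> converges_in_probability M (eta_tilde H \<nu> \<Delta> Y) (\<lambda>_. \<eta> 1 2)"
proof -
  interpret prob_space M by fact
  \<comment> \<open>The absolute covariances of the first \<open>n\<close> increments of component \<open>i\<close> sum to \<open>(n \<Delta>)\<close> to the power
    \<open>2 H\<^sub>i\<close> if \<open>H\<^sub>i > 1/2\<close>, and are of order \<open>n\<close> times \<open>\<Delta>\<close> to the power \<open>2 H\<^sub>i\<close> if \<open>H\<^sub>i < 1/2\<close>; the latter
    is negligible against \<open>(n \<Delta>\<^sup>p)\<^sup>2\<close> only when \<open>H\<^sub>j < 1/2\<close> as well.\<close>
  obtain i j where ij: "(i, j) \<in> {(1, 2), (2, 1)}" "1/2 < H i \<or> H i < 1/2 \<and> H j < 1/2"
  proof (cases "1/2 < H 2")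
    case True
    then show ?thesis using that[of 2 1] by simp
  next
    case False
    then show ?thesis using that[of 1 2] assms(2,3) by fastforce
  qed
  obtain b where b: "b \<longlonglongrightarrow> 0"
    "\<And>n. 0 < n \<Longrightarrow> (\<integral>\<^sup>+\<omega>. ennreal ((eta_tilde H \<nu> \<Delta> Y n \<omega> - \<eta> 1 2)\<^sup>2) \<partial>M) \<le> ennreal (b n)"
    by (rule eta_tilde_mse[OF assms(1,5,6,4) ij assms(7-9)]) blast
  have [measurable]: "Y l t \<in> borel_measurable M" if "l \<in> {1, 2}" for l t
    using assms(6) that by (auto simp: bivariate_fou_def fractional_ou_def)
  have L2: "converges_in_L2 M (eta_tilde H \<nu> \<Delta> Y) (\<lambda>_. \<eta> 1 2)"
  proof (rule converges_in_L2I)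
    show "eta_tilde H \<nu> \<Delta> Y n \<in> borel_measurable M" for n
      unfolding eta_tilde_def[abs_def] by measurable
    \<comment> \<open>At \<open>n = 0\<close> the sum is empty and the estimator is 0, so the error
      is \<open>(\<eta> 1 2)\<^sup>2\<close>; \<open>b\<close> bounds it only for
      \<open>0 < n\<close>.\<close>
    show "(\<integral>\<^sup>+\<omega>. ennreal ((eta_tilde H \<nu> \<Delta> Y n \<omega> - \<eta> 1 2)\<^sup>2) \<partial>M)
        \<le> ennreal (if n = 0 then (\<eta> 1 2)\<^sup>2 else b n)" for n
      using b(2)[of n] by (auto simp: eta_tilde_def emeasure_space_1)
    have "\<forall>\<^sub>F n in sequentially. (if n = 0 then (\<eta> 1 2)\<^sup>2 else b n) = b n"
      using eventually_gt_at_top[of 0] by eventually_elim simp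
    then show "(\<lambda>n. if n = 0 then (\<eta> 1 2)\<^sup>2 else b n) \<longlonglongrightarrow> 0"
      using b(1) tendsto_cong by fastforce
  qed
  then show ?thesis using converges_in_L2_imp_in_probability by blast
qed

end
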